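(* Fix $t$ with $\mathrm{Im}(t)>0$. If $l$ is a ray between $l_n$ and $l_{n-1}$ and $l'$ a ray between $l_{n+1}$ and $l_n$, then $$\mathcal X_{-l,\beta^\vee}(t,\lambda)=\mathcal X_{-l',\beta^\vee}(t,\lambda)\,(1-e^{2\pi i(t+n)/\lambda})^{-1}\quad\text{for }\lambda\in\mathbb H_{-l}\cap\mathbb H_{-l'},$$ $$\mathcal X_{l,\beta^\vee}(t,\lambda)=\mathcal X_{l',\beta^\vee}(t,\lambda)\,(1-e^{-2\pi i(t+n)/\lambda})\quad\text{for }\lambda\in\mathbb H_{l}\cap\mathbb H_{l'}.$$ If $l$ lies between $l_0$ and $l_1$, while $l'$ lies between $-l_0$ and $-l_{-1}$, then on $\mathbb H_l\cap\mathbb H_{l'}$ $$\mathcal X_{l,\beta^\vee}(t,\lambda)=\mathcal X_{l',\beta^\vee}(t,\lambda)\prod_{n>0}(1-e^{-2\pi i(t+n)/\lambda})\prod_{n>0}(1-e^{2\pi i(t-n)/\lambda})^{-1}.$$ Finally, if $l$ lies between $l_0$ and $l_{-1}$, while $l'$ lies between $-l_0$ and $-l_1$, then on $\mathbb H_l\cap\mathbb H_{l'}$ $$\mathcal X_{l',\beta^\vee}(t,\lambda)=\mathcal X_{l,\beta^\vee}(t,\lambda)\prod_{n>0}(1-e^{-2\pi i(t-n)/\lambda})\prod_{n>0}(1-e^{2\pi i(t+n)/\lambda})^{-1}.$$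
   Context: For $\mathrm{Im}(t)>0$ put $l_n:=i\mathbb{R}_+\cdot(t+n)$ ($n\in\mathbb{Z}$) and $l_\infty:=i\mathbb{R}_+$; the BPS rays are $\pm l_n$ ($n\in\mathbb{Z}$) and $\pm l_\infty$. Rays are open half-lines from $0$; "between two rays" means in the open convex sector they bound. For a ray $l$, $\mathbb H_l$ is the open half-plane centered at $l$. For $\lambda\in\mathbb{C}^\times$ away from the BPS rays define $$I_n(t,\lambda):=-\frac{\lambda}{\pi i}\int_{i\mathbb{R}_-(t+n)}\frac{d\lambda'}{(\lambda')^2-\lambda^2}\log\big(1-e^{2\pi i(t+n)/\lambda'}\big),$$ the contour being the ray $i\mathbb{R}_-(t+n)=\{-i(t+n)s:s>0\}$ oriented from $0$ to $\infty$ (on which $e^{2\pi i(t+n)/\lambda'}=e^{-2\pi/s}\in(0,1)$), and $$\mathcal X_{\beta^\vee}(t,\lambda):=\exp\Big(\frac{2\pi iZ_{\beta^\vee}(t)}{\lambda}\Big)\,\mathcal X^{\mathrm{inst}}_{\beta^\vee}(t,\lambda),\qquad \log\mathcal X^{\mathrm{inst}}_{\beta^\vee}(t,\lambda):=I_0(t,\lambda)+\sum_{n>0}\big[I_n(t,\lambda)+I_{-n}(t,\lambda)\big],$$ a convergent (symmetrically summed) series, where $Z_{\beta^\vee}(t)=-\frac1{(2\pi i)^2}\big(\frac12(\log e^{2\pi it})^2+\mathrm{Li}_2(e^{2\pi it})\big)$. For a ray $l$ not equal to a BPS ray, $\mathcal X_{l,\beta^\vee}(t,-):\mathbb H_l\to\mathbb{C}^\times$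 is the holomorphic function that is the analytic continuation to $\mathbb H_l$ of $\mathcal X_{\beta^\vee}(t,-)$ restricted to the sector (inside $\mathbb H_l$) around $l$ bounded by the two consecutive BPS rays adjacent to $l$. It is constructed as follows: for each closed subsector $\Sigma\subset\mathbb H_l$ containing $l$, deform the BPS rays (integration contours, and their negatives) contained in $\mathbb H_l$ to $\mathbb H_l\setminus\Sigma$ without crossing $l$ and maintaining their relative ordering, and similarly deform those contained in $-\mathbb H_l$ to $-(\mathbb H_l\setminus\Sigma)$ without crossing $-l$ and maintaining relative ordering; the resulting integrals define the continuation on $\Sigma$. *)

theory Defs
  imports "HOL-Complex_Analysis.Complex_Analysis" "HOL-Library.FuncSet"
begin

definition ray :: "complex \<Rightarrow> complex set" where
  "ray v = {of_real s * v |s. s > 0}"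

definition is_ray :: "complex set \<Rightarrow> bool" where
  "is_ray l \<longleftrightarrow> (\<exists>v. v \<noteq> 0 \<and> l = ray v)"

abbreviation opposite :: "complex set \<Rightarrow> complex set" where
  "opposite l \<equiv> uminus ` l"

text \<open>For rays that are neither equal nor opposite, the positive combinations of their
  points form the open convex sector bounded by them.\<close>

definition sector :: "complex set \<Rightarrow> complex set \<Rightarrow> complex set" where
  "sector r r' = {a + b |a b. a \<in> r \<and> b \<in> r'}"

definition lies_between :: "complex set \<Rightarrow> complex set \<Rightarrow> complex set \<Rightarrow> bool" where
  "lies_between l r r' \<longleftrightarrow> is_ray l \<and> l \<subseteq> sector r r'"

definition half_plane :: "complex set \<Rightarrow> complex set" where
  "half_plane l = {z. \<forall>v\<in>l. z \<bullet> v > 0}"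

definition bps_ray :: "complex \<Rightarrow> int \<Rightarrow> complex set" where
  "bps_ray t n = ray (\<i> * (t + of_int n))"

definition bps_ray_infinity :: "complex set" where
  "bps_ray_infinity = ray \<i>"

definition bps_rays :: "complex \<Rightarrow> complex set set" where
  "bps_rays t =
     (let R = insert bps_ray_infinity (range (bps_ray t)) in R \<union> opposite ` R)"

text \<open>The integral of \<open>f\<close> along the ray through \<open>d\<close>, oriented from \<open>0\<close> to infinity.\<close>

definition ray_integral :: "complex \<Rightarrow> (complex \<Rightarrow> complex) \<Rightarrow> complex" where
  "ray_integral d f = (LINT s:{0<..}|lborel. f (of_real s * d) * d)"

definition I_int :: "complex \<Rightarrow> int \<Rightarrow> complex \<Rightarrow> complex" where
  "I_int t n z =
     - (z / (of_real pi * \<i>)) *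
       ray_integral (- \<i> * (t + of_int n))
         (\<lambda>u. 1 / (u\<^sup>2 - z\<^sup>2) * Ln (1 - exp (2 * of_real pi * \<i> * (t + of_int n) / u)))"

definition log_X_inst :: "complex \<Rightarrow> complex \<Rightarrow> complex" where
  "log_X_inst t z =
     I_int t 0 z + (\<Sum>k. I_int t (int (Suc k)) z + I_int t (- int (Suc k)) z)"

text \<open>The power series of the dilogarithm; it is only applied inside the unit disc.\<close>

definition Li2 :: "complex \<Rightarrow> complex" where
  "Li2 q = (\<Sum>k. q ^ Suc k / of_nat (Suc k) ^ 2)"

text \<open>The argument \<open>w\<close> is the chosen value of the logarithm of \<open>exp (2 \<pi> i t)\<close>:
  both \<open>w = 2 \<pi> i t\<close> and the principal value are instances.\<close>

definition Z_beta_dual :: "complex \<Rightarrow> complex \<Rightarrow> complex" where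
  "Z_beta_dual w t =
     - (1 / (2 * of_real pi * \<i>)\<^sup>2) * (1 / 2 * w\<^sup>2 + Li2 (exp (2 * of_real pi * \<i> * t)))"

definition X_beta_dual :: "complex \<Rightarrow> complex \<Rightarrow> complex \<Rightarrow> complex" where
  "X_beta_dual w t z =
     exp (2 * of_real pi * \<i> * Z_beta_dual w t / z) * exp (log_X_inst t z)"

text \<open>For a ray \<open>l\<close> that is not a BPS ray exactly one sector occurs in this union. It may
  stick out of the half-plane centred at \<open>l\<close>, since its opening angle can be close to \<open>\<pi>\<close>.\<close>

definition adjacent_sector :: "complex \<Rightarrow> complex set \<Rightarrow> complex set" where
  "adjacent_sector t l =
     \<Union>{sector r r' |r r'. r \<in> bps_rays t \<and> r' \<in> bps_rays t \<and> l \<subseteq> sector r r' \<and>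
          (\<forall>q\<in>bps_rays t. q \<inter> sector r r' = {})}"

text \<open>The analytic continuation to the half-plane centred at \<open>l\<close>, with values in
  \<open>\<complex> - {0}\<close>. Extensionality of the function space fixes the values off the half-plane,
  so that the identity theorem makes the description unique.\<close>

definition X_ray :: "complex \<Rightarrow> complex \<Rightarrow> complex set \<Rightarrow> complex \<Rightarrow> complex" where
  "X_ray w t l =
     (THE f. f \<in> half_plane l \<rightarrow>\<^sub>E - {0} \<and> f holomorphic_on half_plane l \<and>
        (\<forall>z \<in> half_plane l \<inter> adjacent_sector t l. f z = X_beta_dual w t z))"

end

theory Submission imports Defs
begin

text \<open>
  Everything reduces to one function. By the substitution \<open>s \<mapsto> 1 / s\<close>, the integral
  \<open>I_int t n z\<close> depends only on \<open>y = (t + n) / z\<close>: for \<open>Re y > 0\<close> it is Binet's second integral for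
  the remainder \<open>binet y\<close> in Stirling's formula (\<open>ray_integral_eq_binet\<close>), and since it is odd it is
  \<open>- binet (- y)\<close> for \<open>Re y < 0\<close>. The line \<open>Re y = 0\<close> consists of the \<open>z\<close> on the BPS rays
  \<open>l\<^sub>n\<close> and \<open>- l\<^sub>n\<close> and of nothing else, because there \<open>z\<close> is a real multiple of \<open>\<i> (t + n)\<close>.

  In Stieltjes' form, \<open>binet\<close> is holomorphic on the plane slit along the nonpositive reals. Hence the
  continuation belonging to a ray through \<open>v\<close> is obtained by deciding at \<open>v\<close>, for every \<open>n\<close>, between
  \<open>binet y\<close> and \<open>- binet (- y)\<close>, and keeping that choice. On the half-plane centred at \<open>v\<close>
  the arguments so chosen never meet the slit (\<open>quotient_not_nonpos\<close>). As \<open>binet\<close> varies, over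
  bounded distances and away from the slit, by \<open>O(1 / \<bar>y\<bar>\<^sup>2)\<close>, the series over pairs \<open>n, - n\<close> converges locally uniformly
  (\<open>continued_log_converges\<close>). By the identity theorem its exponential, times the exponential of the
  central charge term, is \<open>X_ray\<close> (\<open>X_ray_eq_continued\<close>).

  Two rays therefore differ exactly in those \<open>n\<close> for which \<open>Re ((t + n) / v)\<close> has different signs,
  and each of them contributes \<open>binet y + binet (- y)\<close> up to sign. A residue computation, carried out on each
  Fourier mode of the periodic weight in Stieltjes' integral, gives
  \<open>exp (binet y + binet (- y)) = 1 / (1 - exp (2 \<pi> \<i> y))\<close> for \<open>Im y > 0\<close>
  (\<open>exp_binet_reflection\<close>). For neighbouring rays one sign changes, which yields the first two
  identities. For the rays on the two sides of \<open>l\<^sub>\<infinity>\<close>, or of \<open>- l\<^sub>\<infinity>\<close>, all signs with \<open>n \<noteq> 0\<close> change,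
  and the sum of the contributions exponentiates to the two infinite products.
\<close>

section \<open>Integrals over the half-line\<close>

lemma integral_inverse_power:
  fixes b :: real and n :: nat
  assumes b: "b > 0"
  shows "set_integrable lborel {0..} (\<lambda>x. 1 / (x + b) ^ (n + 2))"
    and "(LINT x:{0..}|lborel. 1 / (x + b) ^ (n + 2)) = 1 / ((n + 1) * b ^ (n + 1))"
proof -
  define F where "F = (\<lambda>x::real. - (1 / real (n + 1)) * inverse (x + b) ^ (n + 1))"
  have der: "DERIV F x :> 1 / (x + b) ^ (n + 2)" if "0 \<le> x" for x
  proof -
    have nz: "x + b \<noteq> 0" using that b by simp
    have inv: "((\<lambda>x. inverse (x + b)) has_real_derivative - (inverse (x + b) ^ 2)) (at x)"
      using nz by (auto intro!: derivative_eq_intros simp: power2_eq_square)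
    have "(F has_real_derivative
        - (1 / real (n + 1)) * (real (n + 1) * inverse (x + b) ^ n * (- (inverse (x + b) ^ 2)))) (at x)"
      unfolding F_def using DERIV_power[OF inv, of "n + 1"]
      by (intro DERIV_cmult) (simp add: mult_ac)
    moreover have "- (1 / real (n + 1)) * (real (n + 1) * inverse (x + b) ^ n * (- (inverse (x + b) ^ 2)))
        = 1 / (x + b) ^ (n + 2)"
      using nz by (simp add: field_simps power_inverse power2_eq_square)
    ultimately show ?thesis by simp
  qed
  have shift: "filterlim (\<lambda>x. x + b) at_top at_top"
    by real_asymp
  have lim: "(F \<longlongrightarrow> 0) at_top"
    unfolding F_def
    by (intro tendsto_mult_right_zero tendsto_null_power tendsto_inverse_0_at_top
          shift) simp
  have nn: "(\<integral>\<^sup>+x. ennreal (1 / (x + b) ^ (n + 2)) * indicator {0..} x \<partial>lborel) = 0 - F 0"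
    by (rule nn_integral_FTC_atLeast[OF _ der _ lim]) (use b in auto)
  have F0: "0 - F 0 = 1 / ((n + 1) * b ^ (n + 1))" by (simp add: F_def power_inverse field_simps)
  have "has_bochner_integral lborel (\<lambda>x. indicator {0..} x *\<^sub>R (1 / (x + b) ^ (n + 2))) (0 - F 0)"
  proof (rule has_bochner_integral_nn_integral)
    show "(\<integral>\<^sup>+x. ennreal (indicator {0..} x *\<^sub>R (1 / (x + b) ^ (n + 2))) \<partial>lborel) = ennreal (0 - F 0)"
      unfolding nn[symmetric] by (intro nn_integral_cong) (auto simp: indicator_def)
  qed (use b in \<open>auto simp: F_def indicator_def\<close>)
  then show "set_integrable lborel {0..} (\<lambda>x. 1 / (x + b) ^ (n + 2))"
    and "(LINT x:{0..}|lborel. 1 / (x + b) ^ (n + 2)) = 1 / ((n + 1) * b ^ (n + 1))"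
    unfolding F0 by (auto simp: set_integrable_def set_lebesgue_integral_def has_bochner_integral_iff)
qed

text \<open>Off the slit, a single direction \<open>v\<close> (the bisector of \<open>y\<close> and the positive axis) has
  positive inner product with \<open>y\<close> and with every \<open>x > 0\<close>, so \<open>x + y\<close> moves away from \<open>0\<close>
  at linear speed, which dominates the kernels \<open>1 / (x + y)\<^sup>2\<close>.\<close>

lemma slit_plane_distance:
  assumes "y \<notin> \<real>\<^sub>\<le>\<^sub>0"
  obtains c where "c > 0" "\<And>x. x \<ge> 0 \<Longrightarrow> c * (x + 1) \<le> cmod (of_real x + y)"
proof -
  have y0: "y \<noteq> 0" using assms by auto
  \<comment> \<open>the bisector of the angle between \<open>y\<close> and the positive axis\<close>
  define v where "v = y / of_real (cmod y) + 1"
  have pos: "cmod y + Re y > 0"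
  proof (rule ccontr)
    assume "\<not> cmod y + Re y > 0"
    then have le: "cmod y \<le> - Re y" by simp
    have "\<bar>Re y\<bar> \<le> cmod y" by (rule abs_Re_le_cmod)
    then have "cmod y = - Re y" "Re y \<le> 0" using le by auto
    then have "cmod y ^ 2 = Re y ^ 2" by simp
    then have "Im y = 0" by (simp add: cmod_power2)
    then show False using assms \<open>Re y \<le> 0\<close> by (simp add: complex_nonpos_Reals_iff)
  qed
  have Rev: "Re v > 0"
  proof -
    have "Re v = (cmod y + Re y) / cmod y" using y0 by (simp add: v_def field_simps)
    then show ?thesis using pos y0 by simp
  qed
  have yv: "y \<bullet> v > 0"
  proof -
    have "y \<bullet> v = (Re y ^ 2 + Im y ^ 2) / cmod y + Re y"
      by (simp add: v_def inner_complex_def power2_eq_square add_divide_distrib algebra_simps)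
    also have "Re y ^ 2 + Im y ^ 2 = cmod y ^ 2" by (simp add: cmod_power2)
    also have "cmod y ^ 2 / cmod y = cmod y" by (simp add: power2_eq_square)
    finally show ?thesis using pos by simp
  qed
  have v0: "cmod v > 0" using Rev by auto
  define c where "c = min (Re v) (y \<bullet> v) / cmod v"
  have "c > 0" using Rev yv v0 by (simp add: c_def)
  moreover have "c * (x + 1) \<le> cmod (of_real x + y)" if "x \<ge> 0" for x
  proof -
    have "min (Re v) (y \<bullet> v) * (x + 1) \<le> x * Re v + y \<bullet> v"
    proof -
      have "min (Re v) (y \<bullet> v) * x \<le> x * Re v" using that
        by (metis min.cobounded1 mult.commute mult_left_mono)
      then show ?thesis by (simp add: algebra_simps)
    qed
    also have "\<dots> = (of_real x + y) \<bullet> v" by (simp add: inner_complex_def algebra_simps)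
    also have "\<dots> \<le> cmod (of_real x + y) * cmod v" by (rule norm_cauchy_schwarz)
    finally show ?thesis using v0 by (simp add: c_def field_simps)
  qed
  ultimately show ?thesis by (rule that)
qed

lemma set_integrable_bounded_over_square:
  fixes g :: "real \<Rightarrow> complex"
  assumes "y \<notin> \<real>\<^sub>\<le>\<^sub>0" and [measurable]: "g \<in> borel_measurable borel"
    and M: "\<And>x. x \<ge> 0 \<Longrightarrow> norm (g x) \<le> M"
  shows "set_integrable lborel {0..} (\<lambda>x. g x / (of_real x + y) ^ (2 + n))"
proof -
  obtain c where c: "c > 0" "\<And>x. x \<ge> 0 \<Longrightarrow> c * (x + 1) \<le> cmod (of_real x + y)"
    using slit_plane_distance[OF assms(1)] by metis
  have "set_integrable lborel {0..} (\<lambda>x. M / c ^ (2 + n) * (1 / (x + 1) ^ (n + 2)))"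
    by (intro set_integrable_mult_right integral_inverse_power) auto
  then show ?thesis
  proof (rule set_integrable_bound)
    show "AE x in lborel. x \<in> {0..} \<longrightarrow> norm (g x / (of_real x + y) ^ (2 + n))
        \<le> norm (M / c ^ (2 + n) * (1 / (x + 1) ^ (n + 2)))"
    proof (intro AE_I2 impI)
      fix x :: real assume "x \<in> {0..}"
      then have x: "x \<ge> 0" by simp
      have "M \<ge> 0" using order_trans[OF norm_ge_zero M[OF x]] .
      have "norm (g x / (of_real x + y) ^ (2 + n)) = norm (g x) / cmod (of_real x + y) ^ (2 + n)"
        by (simp add: norm_divide norm_power norm_mult)
      also have "\<dots> \<le> M / (c * (x + 1)) ^ (2 + n)"
        using c x M[OF x] \<open>M \<ge> 0\<close> by (intro frac_le power_mono) auto
      also have "\<dots> = norm (M / c ^ (2 + n) * (1 / (x + 1) ^ (n + 2)))"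
        using x c \<open>M \<ge> 0\<close> by (simp add: power_mult_distrib add.commute[of 2 n] del: power_Suc)
      finally show "norm (g x / (of_real x + y) ^ (2 + n)) \<le> \<dots>" .
    qed
  qed (auto simp: set_borel_measurable_def)
qed

lemma set_integral_FTC_at_top:
  fixes F f :: "real \<Rightarrow> complex"
  assumes der: "\<And>x. x \<ge> 0 \<Longrightarrow> (F has_vector_derivative f x) (at x)"
    and cont: "continuous_on {0..} f"
    and int: "set_integrable lborel {0..} f"
    and lim: "(F \<longlongrightarrow> L) at_top"
  shows "(LINT x:{0..}|lborel. f x) = L - F 0"
proof (rule tendsto_unique)
  show "((\<lambda>b. LINT x:{0..b}|lborel. f x) \<longlongrightarrow> (LINT x:{0..}|lborel. f x)) at_top"
    by (rule tendsto_set_lebesgue_integral_at_top) (use int in auto)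
  have "\<forall>\<^sub>F b in at_top. (LINT x:{0..b}|lborel. f x) = F b - F 0"
    using eventually_ge_at_top[of 0]
  proof eventually_elim
    case (elim b)
    have "(LBINT x. indicator {0..b} x *\<^sub>R f x) = F b - F 0"
      by (rule integral_FTC_Icc)
        (use elim der cont in \<open>auto intro: has_vector_derivative_at_within continuous_on_subset\<close>)
    then show ?case by (simp add: set_lebesgue_integral_def)
  qed
  moreover have "((\<lambda>b. F b - F 0) \<longlongrightarrow> L - F 0) at_top"
    by (intro tendsto_intros lim)
  ultimately show "((\<lambda>b. LINT x:{0..b}|lborel. f x) \<longlongrightarrow> L - F 0) at_top"
    using tendsto_cong by fastforce
qed simp

section \<open>The Stirling remainder on the slit plane\<close>

text \<open>The Fourier series of \<open>({x} - {x}\<^sup>2) / 2\<close>, with \<open>{x}\<close> the fractional part. The series is the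
  definition because the proofs work mode by mode.\<close>

definition weight :: "real \<Rightarrow> real" where
  "weight x = (\<Sum>k. (1 - cos (2 * pi * Suc k * x)) / (2 * pi\<^sup>2 * (Suc k)\<^sup>2))"

text \<open>The remainder \<open>ln \<Gamma>(y) - ((y - 1/2) ln y - y + ln (2 \<pi>) / 2)\<close> in Stirling's formula, in
  Stieltjes' form. Binet's classical integral makes sense for \<open>Re y > 0\<close> only; this one lives on
  the plane slit along the nonpositive reals, and that gain is what makes it the right continuation.\<close>

definition binet :: "complex \<Rightarrow> complex" where
  "binet y = (LINT x:{0..}|lborel. of_real (weight x) / (of_real x + y)\<^sup>2)"

lemma summable_over_squares: "summable (\<lambda>k. C / (real (Suc k))\<^sup>2)"
proof -
  have "summable (\<lambda>k. C * inverse (real (Suc k) ^ 2))"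
    by (intro summable_mult) (subst summable_Suc_iff, rule inverse_power_summable, simp)
  then show ?thesis by (simp add: divide_inverse)
qed

lemma weight_term_bound:
  "\<bar>(1 - cos (2 * pi * Suc k * x)) / (2 * pi\<^sup>2 * (Suc k)\<^sup>2)\<bar> \<le> 1 / (Suc k)\<^sup>2"
proof -
  have "\<bar>1 - cos (2 * pi * Suc k * x)\<bar> \<le> 2"
    using cos_le_one[of "2 * pi * Suc k * x"] cos_ge_minus_one[of "2 * pi * Suc k * x"] by linarith
  also have "2 \<le> 2 * pi\<^sup>2" using one_le_power[of pi 2] pi_gt3 by simp
  finally have "\<bar>1 - cos (2 * pi * Suc k * x)\<bar> / (2 * pi\<^sup>2 * (Suc k)\<^sup>2)
      \<le> 2 * pi\<^sup>2 / (2 * pi\<^sup>2 * (Suc k)\<^sup>2)"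
    by (rule divide_right_mono) simp
  also have "\<dots> = 1 / (Suc k)\<^sup>2" by simp
  finally show ?thesis by simp
qed

lemma summable_weight:
  "summable (\<lambda>k. \<bar>(1 - cos (2 * pi * Suc k * x)) / (2 * pi\<^sup>2 * (Suc k)\<^sup>2)\<bar>)"
  by (rule summable_comparison_test'[OF summable_over_squares[of 1], of 0])
     (use weight_term_bound in \<open>simp del: of_nat_Suc abs_divide\<close>)

lemma weight_bounded: "\<bar>weight x\<bar> \<le> (\<Sum>k. 1 / (real (Suc k))\<^sup>2)"
proof -
  have "\<bar>weight x\<bar> \<le> (\<Sum>k. \<bar>(1 - cos (2 * pi * Suc k * x)) / (2 * pi\<^sup>2 * (Suc k)\<^sup>2)\<bar>)"
    unfolding weight_def by (rule summable_rabs[OF summable_weight])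
  also have "\<dots> \<le> (\<Sum>k. 1 / (real (Suc k))\<^sup>2)"
    using weight_term_bound summable_weight summable_over_squares
    by (intro suminf_le) (simp_all del: of_nat_Suc abs_divide)
  finally show ?thesis .
qed

lemma weight_measurable [measurable]: "weight \<in> borel_measurable borel"
  unfolding weight_def by measurable

lemma norm_set_integral_le:
  fixes f :: "real \<Rightarrow> complex"
  assumes "set_integrable M A f" "set_integrable M A g" "\<And>x. x \<in> A \<Longrightarrow> norm (f x) \<le> g x"
  shows "norm (LINT x:A|M. f x) \<le> (LINT x:A|M. g x)"
  unfolding set_lebesgue_integral_def
  by (rule Bochner_Integration.integral_norm_bound_integral)
     (use assms in \<open>auto simp: set_integrable_def indicator_def\<close>)

definition weight_bound :: real where "weight_bound = (\<Sum>k. 1 / (real (Suc k))\<^sup>2)"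

lemma norm_weight_le: "norm (complex_of_real (weight x)) \<le> weight_bound"
  using weight_bounded[of x] by (simp add: weight_bound_def)

lemma weight_bound_nonneg: "weight_bound \<ge> 0"
  using order_trans[OF norm_ge_zero norm_weight_le[of 0]] .

lemma set_integrable_weight:
  fixes y :: complex
  shows "y \<notin> \<real>\<^sub>\<le>\<^sub>0 \<Longrightarrow> set_integrable lborel {0..} (\<lambda>x. of_real (weight x) / (of_real x + y) ^ (2 + n))"
  by (rule set_integrable_bounded_over_square) (use norm_weight_le in auto)

text \<open>The difference quotient is compared with the integral of the derivative of the kernel: the
  error of the kernel is of second order in \<open>h\<close>, with a constant integrable in \<open>x\<close>.\<close>

lemma binet_has_field_derivative:
  assumes y: "y \<notin> \<real>\<^sub>\<le>\<^sub>0"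
  shows "(binet has_field_derivative
           (-2 * (LINT x:{0..}|lborel. of_real (weight x) / (of_real x + y) ^ 3))) (at y)"
proof -
  define D where "D = -2 * (LINT x:{0..}|lborel. of_real (weight x) / (of_real x + y) ^ 3)"
  obtain c where c: "c > 0" "\<And>x. x \<ge> 0 \<Longrightarrow> c * (x + 1) \<le> cmod (of_real x + y)"
    using slit_plane_distance[OF y] by metis
  define K where "K = 16 * weight_bound / c ^ 4 * (1 / 3)"
  have bound: "norm (binet (y + h) - binet y - h * D) \<le> K * norm h ^ 2" if h: "norm h \<le> c / 2" for h
  proof -
    have w: "norm h \<le> cmod (of_real x + y) / 2" "cmod (of_real x + y) / 2 \<le> cmod (of_real x + (y + h))"
      "c * (x + 1) \<le> cmod (of_real x + y)" "cmod (of_real x + y) > 0" if x: "x \<ge> 0" for x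
    proof -
      show 1: "c * (x + 1) \<le> cmod (of_real x + y)" by (rule c(2)[OF x])
      moreover have "c * 1 \<le> c * (x + 1)" using c(1) x by (intro mult_left_mono) auto
      ultimately show 2: "norm h \<le> cmod (of_real x + y) / 2" "cmod (of_real x + y) > 0"
        using h c(1) by linarith+
      have "cmod (of_real x + y) - norm h \<le> cmod (of_real x + y + h)"
        by (rule norm_diff_ineq)
      with 2 show "cmod (of_real x + y) / 2 \<le> cmod (of_real x + (y + h))"
        by (simp add: add.assoc)
    qed
    have yh: "y + h \<notin> \<real>\<^sub>\<le>\<^sub>0"
    proof
      assume "y + h \<in> \<real>\<^sub>\<le>\<^sub>0"
      then obtain r where r: "y + h = of_real r" "r \<le> 0" by (auto elim!: nonpos_Reals_cases)
      from w(2)[of "- r"] w(4)[of "- r"] r show False by simp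
    qed
    let ?W = "\<lambda>x. complex_of_real (weight x)"
    have i1: "set_integrable lborel {0..} (\<lambda>x. ?W x / (of_real x + (y + h)) ^ 2)"
      and i2: "set_integrable lborel {0..} (\<lambda>x. ?W x / (of_real x + y) ^ 2)"
      and i3: "set_integrable lborel {0..} (\<lambda>x. ?W x / (of_real x + y) ^ 3)"
      using set_integrable_weight[OF yh, of 0] set_integrable_weight[OF y, of 0]
        set_integrable_weight[OF y, of 1] by simp_all
    let ?f = "\<lambda>x. ?W x / (of_real x + (y + h)) ^ 2 - ?W x / (of_real x + y) ^ 2
       - (- 2 * h) * (?W x / (of_real x + y) ^ 3)"
    have int_f: "set_integrable lborel {0..} ?f"
      by (intro set_integral_diff set_integrable_mult_right i1 i2 i3)
    have "binet (y + h) - binet y - h * D = (LINT x:{0..}|lborel. ?f x)"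
      unfolding binet_def D_def
        set_integral_diff(2)[OF set_integral_diff(1)[OF i1 i2] set_integrable_mult_right[OF i3]]
        set_integral_diff(2)[OF i1 i2] set_integral_mult_right
      by simp
    also have "norm \<dots> \<le> (LINT x:{0..}|lborel. 16 * weight_bound / c ^ 4 * norm h ^ 2 * (1 / (x + 1) ^ (2 + 2)))"
    proof (rule norm_set_integral_le[OF int_f])
      show "set_integrable lborel {0..} (\<lambda>x::real. 16 * weight_bound / c ^ 4 * norm h ^ 2 * (1 / (x + 1) ^ (2 + 2)))"
        by (intro set_integrable_mult_right integral_inverse_power) auto
      fix x :: real assume "x \<in> {0..}"
      then have x: "x \<ge> 0" by simp
      define u where "u = of_real x + y"
      have u: "norm h \<le> norm u / 2" "norm u / 2 \<le> norm (u + h)" "c * (x + 1) \<le> norm u" "norm u > 0"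
        using w[OF x] by (auto simp: u_def add.assoc)
      have nz: "u \<noteq> 0" "u + h \<noteq> 0" using u by auto
      have "?f x = ?W x * (1 / (u + h) ^ 2 - 1 / u ^ 2 + 2 * h / u ^ 3)"
        by (simp add: u_def algebra_simps)
      also have "1 / (u + h) ^ 2 - 1 / u ^ 2 + 2 * h / u ^ 3 = h ^ 2 * (3 * u + 2 * h) / (u ^ 3 * (u + h) ^ 2)"
        using nz by (simp add: divide_simps) algebra
      finally have "norm (?f x) = norm (?W x) * (norm h ^ 2 * norm (3 * u + 2 * h) / (norm u ^ 3 * norm (u + h) ^ 2))"
        by (simp add: norm_mult norm_divide norm_power)
      also have "\<dots> \<le> weight_bound * (norm h ^ 2 * (4 * norm u) / (norm u ^ 3 * (norm u / 2) ^ 2))"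
      proof (intro mult_mono norm_weight_le frac_le mult_left_mono power_mono)
        have "norm (3 * u + 2 * h) \<le> 3 * norm u + 2 * norm h"
          by (rule norm_triangle_le) (simp add: norm_mult)
        then show "norm (3 * u + 2 * h) \<le> 4 * norm u" using u by simp
      qed (use u nz weight_bound_nonneg in auto)
      also have "\<dots> = 16 * weight_bound * norm h ^ 2 / norm u ^ 4"
        using nz by (simp add: field_simps power2_eq_square power3_eq_cube power4_eq_xxxx)
      also have "\<dots> \<le> 16 * weight_bound * norm h ^ 2 / (c * (x + 1)) ^ 4"
        using u c x weight_bound_nonneg by (intro divide_left_mono power_mono) auto
      also have "\<dots> = 16 * weight_bound / c ^ 4 * norm h ^ 2 * (1 / (x + 1) ^ (2 + 2))"
        by (simp add: power_mult_distrib)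
      finally show "norm (?f x) \<le> \<dots>" .
    qed
    also have "\<dots> = K * norm h ^ 2"
      unfolding set_integral_mult_right integral_inverse_power(2)[OF zero_less_one]
      by (simp add: K_def)
    finally show ?thesis .
  qed
  have "((\<lambda>h. (binet (y + h) - binet y) / h - D) \<longlongrightarrow> 0) (at 0)"
  proof (rule Lim_null_comparison)
    show "((\<lambda>h. K * norm h) \<longlongrightarrow> 0) (at (0::complex))"
      by (auto intro!: tendsto_eq_intros)
    have "\<forall>\<^sub>F h in at 0. h \<noteq> 0 \<and> norm (h::complex) < c / 2"
      using c(1) by (auto simp: eventually_at intro!: exI[of _ "c/2"])
    then show "\<forall>\<^sub>F h in at 0. norm ((binet (y + h) - binet y) / h - D) \<le> K * norm h"
    proof eventually_elim
      case (elim h)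
      then have "norm ((binet (y + h) - binet y) / h - D) = norm (binet (y + h) - binet y - h * D) / norm h"
        by (simp add: norm_divide[symmetric] diff_divide_distrib)
      also have "\<dots> \<le> K * norm h ^ 2 / norm h" using elim by (intro divide_right_mono bound) auto
      finally show ?case using elim by (simp add: power2_eq_square)
    qed
  qed
  then have "((\<lambda>h. (binet (y + h) - binet y) / h) \<longlongrightarrow> D) (at 0)"
    by (simp add: LIM_zero_iff)
  then show ?thesis by (simp add: DERIV_def D_def)
qed

lemma binet_holomorphic: "binet holomorphic_on (- \<real>\<^sub>\<le>\<^sub>0)"
  using binet_has_field_derivative
  by (auto simp: holomorphic_on_def field_differentiable_def intro: has_field_derivative_at_within)

text \<open>One Fourier mode of \<open>binet\<close>, up to its coefficient.\<close>

definition mode :: "real \<Rightarrow> complex \<Rightarrow> complex" where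
  "mode a y = (LINT x:{0..}|lborel. of_real (1 - cos (a * x)) / (of_real x + y)\<^sup>2)"

lemma modes_sums_binet:
  assumes y: "y \<notin> \<real>\<^sub>\<le>\<^sub>0"
  shows "(\<lambda>k. of_real (1 / (2 * pi\<^sup>2 * (Suc k)\<^sup>2)) * mode (2 * pi * Suc k) y) sums binet y"
proof -
  obtain c where c: "c > 0" "\<And>x. x \<ge> 0 \<Longrightarrow> c * (x + 1) \<le> cmod (of_real x + y)"
    using slit_plane_distance[OF y] by metis
  define t where "t = (\<lambda>k x. (1 - cos (2 * pi * real (Suc k) * x)) / (2 * pi\<^sup>2 * (Suc k)\<^sup>2))"
  have [measurable]: "t k \<in> borel_measurable borel" for k by (simp add: t_def)
  have t_le: "norm (complex_of_real (t k x)) \<le> 1 / (Suc k)\<^sup>2" for k x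
    using weight_term_bound[of k x] unfolding t_def norm_of_real by (simp del: of_nat_Suc abs_divide)
  have t_sum: "summable (\<lambda>k. norm (complex_of_real (t k x)))" for x
    using summable_weight[of x] unfolding t_def norm_of_real .
  let ?g = "\<lambda>k x. complex_of_real (t k x) / (of_real x + y)\<^sup>2"
  have int_g: "set_integrable lborel {0..} (?g k)" for k
    using set_integrable_bounded_over_square[OF y, of "\<lambda>x. of_real (t k x)" _ 0] t_le by fastforce
  have int_norm: "(LINT x:{0..}|lborel. norm (?g k x)) \<le> 1 / c\<^sup>2 / (real (Suc k))\<^sup>2" for k
  proof -
    have "(LINT x:{0..}|lborel. norm (?g k x)) \<le> (LINT x:{0..}|lborel. 1 / c\<^sup>2 / (real (Suc k))\<^sup>2 * (1 / (x + 1) ^ (0 + 2)))"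
    proof (rule set_integral_mono)
      show "set_integrable lborel {0..} (\<lambda>x. norm (?g k x))"
        by (rule set_integrable_norm[OF int_g])
      show "set_integrable lborel {0..} (\<lambda>x::real. 1 / c\<^sup>2 / (real (Suc k))\<^sup>2 * (1 / (x + 1) ^ (0 + 2)))"
        by (intro set_integrable_mult_right integral_inverse_power) auto
      fix x :: real assume "x \<in> {0..}"
      then have x: "x \<ge> 0" by simp
      have "norm (?g k x) = norm (complex_of_real (t k x)) / norm (of_real x + y) ^ 2"
        by (simp add: norm_divide norm_power)
      also have "\<dots> \<le> (1 / (Suc k)\<^sup>2) / (c * (x + 1))\<^sup>2"
        using c x by (intro frac_le t_le power_mono) auto
      also have "\<dots> = 1 / c\<^sup>2 / (real (Suc k))\<^sup>2 * (1 / (x + 1) ^ (0 + 2))"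
        by (simp add: power_mult_distrib power2_eq_square mult_ac of_nat_power del: of_nat_Suc mult_Suc mult_Suc_right)
      finally show "norm (?g k x) \<le> \<dots>" .
    qed
    also have "\<dots> = 1 / c\<^sup>2 / (real (Suc k))\<^sup>2"
      unfolding set_integral_mult_right integral_inverse_power(2)[OF zero_less_one] by simp
    finally show ?thesis .
  qed
  have "(\<lambda>k. LINT x|lborel. indicator {0..} x *\<^sub>R ?g k x) sums
        (LINT x|lborel. (\<Sum>k. indicator {0..} x *\<^sub>R ?g k x))"
  proof (rule sums_integral)
    show "integrable lborel (\<lambda>x. indicator {0..} x *\<^sub>R ?g k x)" for k
      using int_g[of k] by (simp add: set_integrable_def)
    show "AE x in lborel. summable (\<lambda>k. norm (indicator {0..} x *\<^sub>R ?g k x))"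
    proof (rule AE_I2)
      fix x
      have "summable (\<lambda>k. norm (indicator {0..} x / (of_real x + y)\<^sup>2) * norm (complex_of_real (t k x)))"
        by (intro summable_mult t_sum)
      then show "summable (\<lambda>k. norm (indicator {0..} x *\<^sub>R ?g k x))"
        by (cases "x \<ge> 0") (simp_all add: norm_divide norm_mult norm_power indicator_def mult_ac)
    qed
    show "summable (\<lambda>k. LINT x|lborel. norm (indicator {0..} x *\<^sub>R ?g k x))"
    proof (rule summable_comparison_test'[OF summable_over_squares, of 0])
      fix k :: nat
      have nonneg: "0 \<le> (LINT x|lborel. norm (indicator {0..} x *\<^sub>R ?g k x))"
        by (rule Bochner_Integration.integral_nonneg) simp
      have "(LINT x|lborel. norm (indicator {0..} x *\<^sub>R ?g k x)) = (LINT x:{0..}|lborel. norm (?g k x))"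
        by (simp add: set_lebesgue_integral_def)
      then show "norm (LINT x|lborel. norm (indicator {0..} x *\<^sub>R ?g k x)) \<le> 1 / c\<^sup>2 / (real (Suc k))\<^sup>2"
        using int_norm[of k] nonneg by (simp only: real_norm_def abs_of_nonneg)
    qed
  qed
  moreover have "(LINT x|lborel. indicator {0..} x *\<^sub>R ?g k x)
      = of_real (1 / (2 * pi\<^sup>2 * (Suc k)\<^sup>2)) * mode (2 * pi * Suc k) y" for k
  proof -
    have "(LINT x|lborel. indicator {0..} x *\<^sub>R ?g k x) = (LINT x:{0..}|lborel.
        complex_of_real (1 / (2 * pi\<^sup>2 * (Suc k)\<^sup>2)) * (of_real (1 - cos (2 * pi * Suc k * x)) / (of_real x + y)\<^sup>2))"
      by (simp add: set_lebesgue_integral_def t_def del: of_nat_Suc)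
    then show ?thesis unfolding set_integral_mult_right mode_def .
  qed
  moreover have "(\<Sum>k. indicator {0..} x *\<^sub>R ?g k x) = indicator {0..} x *\<^sub>R (of_real (weight x) / (of_real x + y)\<^sup>2)" for x
  proof -
    have "(\<lambda>k. complex_of_real (t k x)) sums of_real (weight x)"
      unfolding weight_def t_def
      by (intro sums_of_real summable_sums summable_rabs_cancel[OF summable_weight])
    then have "(\<lambda>k. indicator {0..} x *\<^sub>R ?g k x) sums (indicator {0..} x *\<^sub>R (of_real (weight x) / (of_real x + y)\<^sup>2))"
      by (intro sums_scaleR_right sums_divide)
    then show ?thesis by (rule sums_unique[symmetric])
  qed
  ultimately show ?thesis by (simp add: binet_def set_lebesgue_integral_def)
qed

section \<open>Moving contours to infinity\<close>

lemma norm_contour_integral_linepath_le: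
  assumes "continuous_on (closed_segment a b) f" "0 \<le> B" "\<And>z. z \<in> closed_segment a b \<Longrightarrow> norm (f z) \<le> B"
  shows "norm (contour_integral (linepath a b) f) \<le> B * norm (b - a)"
  by (rule has_contour_integral_bound_linepath
      [OF has_contour_integral_integral[OF contour_integrable_continuous_linepath[OF assms(1)]] assms(2,3)])

text \<open>The sides are spelled out so that a rectangle can be split into the sides that carry the
  integral of interest and the remote ones that contribute nothing in the limit.\<close>

lemma contour_integral_rectpath:
  assumes cont: "continuous_on (path_image (rectpath a c)) f"
  shows "contour_integral (rectpath a c) f =
      contour_integral (linepath a (Complex (Re c) (Im a))) f
    + contour_integral (linepath (Complex (Re c) (Im a)) c) f
    + contour_integral (linepath c (Complex (Re a) (Im c))) f
    + contour_integral (linepath (Complex (Re a) (Im c)) a) f"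
proof -
  define b d where "b = Complex (Re c) (Im a)" "d = Complex (Re a) (Im c)"
  have rp: "rectpath a c = linepath a b +++ linepath b c +++ linepath c d +++ linepath d a"
    by (simp add: rectpath_def Let_def b_d_def)
  have "path_image (rectpath a c) = closed_segment a b \<union> closed_segment b c \<union> closed_segment c d \<union> closed_segment d a"
    unfolding rp by (simp add: path_image_join Un_assoc)
  then have "f contour_integrable_on linepath a b" "f contour_integrable_on linepath b c"
    "f contour_integrable_on linepath c d" "f contour_integrable_on linepath d a"
    using cont by (auto intro!: contour_integrable_continuous_linepath intro: continuous_on_subset)
  then show ?thesis unfolding rp
    by (simp add: b_d_def[symmetric] contour_integrable_joinI add.assoc)
qed

lemma tendsto_over_square:
  fixes C :: real shows "((\<lambda>R. K * R * (C / R\<^sup>2)) \<longlongrightarrow> 0) at_top"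
  by real_asymp

text \<open>Cauchy's theorem on the square with corners \<open>0\<close> and \<open>R + \<i> R\<close>: quadratic decay makes
  the two remote sides \<open>O(1 / R)\<close>.\<close>

lemma rotate_half_line:
  fixes f :: "complex \<Rightarrow> complex"
  defines "Q \<equiv> {z. Re z \<ge> 0 \<and> Im z \<ge> 0}"
  assumes holo: "f holomorphic_on Q"
    and bound: "\<And>z. z \<in> Q \<Longrightarrow> norm z \<ge> R0 \<Longrightarrow> norm (f z) \<le> C / (norm z)\<^sup>2"
    and int1: "set_integrable lborel {0..} (\<lambda>x. f (of_real x))"
    and int2: "set_integrable lborel {0..} (\<lambda>x. f (\<i> * of_real x))"
  shows "(LINT x:{0..}|lborel. f (of_real x)) = \<i> * (LINT x:{0..}|lborel. f (\<i> * of_real x))"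
proof -
  have cont: "continuous_on Q f" using holo by (rule holomorphic_on_imp_continuous_on)
  have imag_eq: "Complex 0 x = \<i> * of_real x" for x by (simp add: complex_eq_iff)
  define A where "A = (\<lambda>R. (LINT x:{0..R}|lborel. f (of_real x)) - \<i> * (LINT x:{0..R}|lborel. f (\<i> * of_real x)))"
  have lim: "(A \<longlongrightarrow> (LINT x:{0..}|lborel. f (of_real x)) - \<i> * (LINT x:{0..}|lborel. f (\<i> * of_real x))) at_top"
    unfolding A_def
    by (intro tendsto_intros tendsto_set_lebesgue_integral_at_top int1 int2) auto
  have "(A \<longlongrightarrow> 0) at_top"
  proof (rule Lim_null_comparison)
    show "((\<lambda>R. 2 * R * (max C 0 / R\<^sup>2)) \<longlongrightarrow> 0) at_top" by (rule tendsto_over_square)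
    show "\<forall>\<^sub>F R in at_top. norm (A R) \<le> 2 * R * (max C 0 / R\<^sup>2)"
      using eventually_ge_at_top[of "max R0 1"]
    proof eventually_elim
      case (elim R)
      then have R: "R \<ge> R0" "R > 0" by auto
      define P where "P = rectpath 0 (Complex R R)"
      have sub: "cbox 0 (Complex R R) \<subseteq> Q" by (auto simp: Q_def in_cbox_complex_iff)
      have pi: "path_image P \<subseteq> cbox 0 (Complex R R)"
        unfolding P_def by (rule path_image_rectpath_subset_cbox) (use R in auto)
      have "(f has_contour_integral 0) P"
        by (rule Cauchy_theorem_convex_simple[of _ "cbox 0 (Complex R R)"])
          (use holo sub pi in \<open>auto simp: P_def intro: holomorphic_on_subset\<close>)
      then have "0 = contour_integral P f" by (simp add: contour_integral_unique)
      also have "\<dots> = contour_integral (linepath 0 (Complex R 0)) f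
        + contour_integral (linepath (Complex R 0) (Complex R R)) f
        + contour_integral (linepath (Complex R R) (Complex 0 R)) f
        + contour_integral (linepath (Complex 0 R) 0) f"
        unfolding P_def
        by (subst contour_integral_rectpath)
           (use continuous_on_subset[OF cont order_trans[OF pi sub]] in \<open>auto simp: P_def\<close>)
      also have "contour_integral (linepath (Complex 0 R) 0) f = - contour_integral (linepath 0 (Complex 0 R)) f"
        by (rule contour_integral_reverse_linepath)
           (rule continuous_on_subset[OF cont], use R in \<open>auto simp: Q_def closed_segment_same_Re closed_segment_eq_real_ivl\<close>)
      also have "contour_integral (linepath 0 (Complex 0 R)) f = \<i> * integral {0..R} (\<lambda>x. f (Complex 0 x))"
        by (rule contour_integral_linepath_same_Re) (use R in auto)
      also have "contour_integral (linepath 0 (Complex R 0)) f = integral {0..R} (\<lambda>x. f (of_real x))"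
        using contour_integral_linepath_Reals_eq[of 0 "Complex R 0" f] R by (simp add: complex_is_Real_iff)
      also have "integral {0..R} (\<lambda>x. f (of_real x)) = (LINT x:{0..R}|lborel. f (of_real x))"
        by (subst set_borel_integral_eq_integral(2)[OF set_integrable_subset[OF int1]])
           auto
      also have "integral {0..R} (\<lambda>x. f (Complex 0 x)) = (LINT x:{0..R}|lborel. f (\<i> * of_real x))"
        by (subst set_borel_integral_eq_integral(2)[OF set_integrable_subset[OF int2]])
           (auto simp: imag_eq)
      finally have AR: "A R = - (contour_integral (linepath (Complex R 0) (Complex R R)) f
        + contour_integral (linepath (Complex R R) (Complex 0 R)) f)"
        by (simp add: A_def algebra_simps eq_neg_iff_add_eq_0)
      have "norm (A R) \<le> norm (contour_integral (linepath (Complex R 0) (Complex R R)) f)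
        + norm (contour_integral (linepath (Complex R R) (Complex 0 R)) f)"
        unfolding AR norm_minus_cancel by (rule norm_triangle_ineq)
      also have "\<dots> \<le> max C 0 / R\<^sup>2 * norm (Complex R R - Complex R 0) + max C 0 / R\<^sup>2 * norm (Complex 0 R - Complex R R)"
      proof (intro add_mono norm_contour_integral_linepath_le)
        have far: "norm (f z) \<le> max C 0 / R\<^sup>2" if "z \<in> Q" "norm z \<ge> R" for z
        proof -
          have "norm (f z) \<le> C / (norm z)\<^sup>2" using that R by (intro bound) auto
          also have "\<dots> \<le> max C 0 / R\<^sup>2" using that R by (intro frac_le power_mono) auto
          finally show ?thesis .
        qed
        have s1: "z \<in> Q \<and> norm z \<ge> R" if "z \<in> closed_segment (Complex R 0) (Complex R R)" for z
          using that R abs_Re_le_cmod[of z] by (auto simp: Q_def closed_segment_same_Re closed_segment_eq_real_ivl)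
        have s2: "z \<in> Q \<and> norm z \<ge> R" if "z \<in> closed_segment (Complex R R) (Complex 0 R)" for z
          using that R abs_Im_le_cmod[of z] by (auto simp: Q_def closed_segment_same_Im closed_segment_eq_real_ivl)
        show "continuous_on (closed_segment (Complex R 0) (Complex R R)) f"
          "continuous_on (closed_segment (Complex R R) (Complex 0 R)) f"
          using s1 s2 by (auto intro: continuous_on_subset[OF cont])
        show "norm (f z) \<le> max C 0 / R\<^sup>2" if "z \<in> closed_segment (Complex R 0) (Complex R R)" for z
          using s1 far that by auto
        show "norm (f z) \<le> max C 0 / R\<^sup>2" if "z \<in> closed_segment (Complex R R) (Complex 0 R)" for z
          using s2 far that by auto
      qed auto
      also have "\<dots> = 2 * R * (max C 0 / R\<^sup>2)"
        using R by (simp add: cmod_def)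
      finally show ?case .
    qed
  qed
  with lim have "(LINT x:{0..}|lborel. f (of_real x)) - \<i> * (LINT x:{0..}|lborel. f (\<i> * of_real x)) = 0"
    using tendsto_unique[OF _ lim] by auto
  then show ?thesis by simp
qed

text \<open>The residue theorem on the rectangle over \<open>[-R, R]\<close> of height \<open>R\<close>. The integral over the line
  is written as two half-line integrals, the shape in which \<open>binet y\<close> and \<open>binet (- y)\<close>
  will appear.\<close>

lemma upper_half_plane_residue:
  fixes f :: "complex \<Rightarrow> complex" and R0 :: real
  defines "H \<equiv> {z. Im z \<ge> 0}"
  assumes holo: "f holomorphic_on UNIV - {p}" and p: "Im p \<noteq> 0"
    and bound: "\<And>z. z \<in> H \<Longrightarrow> norm z \<ge> R0 \<Longrightarrow> norm (f z) \<le> C / (norm z)\<^sup>2"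
    and int1: "set_integrable lborel {0..} (\<lambda>x. f (of_real x))"
    and int2: "set_integrable lborel {0..} (\<lambda>x. f (- of_real x))"
  shows "(LINT x:{0..}|lborel. f (of_real x)) + (LINT x:{0..}|lborel. f (- of_real x)) =
    (if Im p > 0 then 2 * pi * \<i> * residue f p else 0)"
proof -
  define rs where "rs = (if Im p > 0 then 2 * pi * \<i> * residue f p else 0)"
  have cont: "continuous_on (UNIV - {p}) f" using holo by (rule holomorphic_on_imp_continuous_on)
  define A where "A = (\<lambda>R. (LINT x:{0..R}|lborel. f (of_real x)) + (LINT x:{0..R}|lborel. f (- of_real x)))"
  have lim: "(A \<longlongrightarrow> (LINT x:{0..}|lborel. f (of_real x)) + (LINT x:{0..}|lborel. f (- of_real x))) at_top"
    unfolding A_def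
    by (intro tendsto_intros tendsto_set_lebesgue_integral_at_top int1 int2) auto
  have "((\<lambda>R. A R - rs) \<longlongrightarrow> 0) at_top"
  proof (rule Lim_null_comparison)
    show "((\<lambda>R. 4 * R * (max C 0 / R\<^sup>2)) \<longlongrightarrow> 0) at_top" by (rule tendsto_over_square)
    show "\<forall>\<^sub>F R in at_top. norm (A R - rs) \<le> 4 * R * (max C 0 / R\<^sup>2)"
      using eventually_gt_at_top[of "max (max R0 1) (norm p)"]
    proof eventually_elim
      case (elim R)
      then have R: "R \<ge> R0" "R > 0" "norm p < R" by auto
      define a c where "a = Complex (-R) 0" "c = Complex R R"
      define P where "P = rectpath a c"
      have ac [simp]: "Re a = -R" "Im a = 0" "Re c = R" "Im c = R" by (auto simp: a_c_def)
      have pR: "\<bar>Re p\<bar> < R" "\<bar>Im p\<bar> < R" using R abs_Re_le_cmod[of p] abs_Im_le_cmod[of p] by auto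
      have pim: "path_image P = cbox a c - box a c"
        unfolding P_def by (rule path_image_rectpath_cbox_minus_box) (use R in auto)
      have p_out: "p \<notin> path_image P"
        unfolding pim using p pR by (auto simp: in_cbox_complex_iff in_box_complex_iff)
      have cP: "continuous_on (path_image P) f"
        by (rule continuous_on_subset[OF cont]) (use p_out in auto)
      have "contour_integral P f = 2 * pi * \<i> * (\<Sum>q\<in>{p}. winding_number P q * residue f q)"
        by (rule Residue_theorem[of UNIV]) (use holo p_out in \<open>auto simp: P_def\<close>)
      also have "\<dots> = rs"
      proof (cases "Im p > 0")
        case True
        then have "winding_number P p = 1" unfolding P_def
          by (intro winding_number_rectpath) (use pR in \<open>auto simp: in_box_complex_iff\<close>)
        then show ?thesis using True by (simp add: rs_def)
      next
        case False
        then have "winding_number P p = 0" unfolding P_def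
          by (intro winding_number_rectpath_outside) (use p R in \<open>auto simp: in_cbox_complex_iff\<close>)
        then show ?thesis using False by (simp add: rs_def)
      qed
      finally have "rs = contour_integral P f" ..
      also have "\<dots> = contour_integral (linepath a (Complex R 0)) f
        + contour_integral (linepath (Complex R 0) c) f
        + contour_integral (linepath c (Complex (-R) R)) f
        + contour_integral (linepath (Complex (-R) R) a) f"
        using contour_integral_rectpath[OF cP[unfolded P_def]] by (simp add: P_def)
      also have "contour_integral (linepath a (Complex R 0)) f = integral {-R..R} (\<lambda>x. f (of_real x))"
        using contour_integral_linepath_Reals_eq[of a "Complex R 0" f] R by (simp add: complex_is_Real_iff)
      also have "integral {-R..R} (\<lambda>x. f (of_real x)) = integral {-R..0} (\<lambda>x. f (of_real x)) + integral {0..R} (\<lambda>x. f (of_real x))"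
      proof (rule Henstock_Kurzweil_Integration.integral_combine[symmetric])
        show "(\<lambda>x. f (of_real x)) integrable_on {-R..R}"
          by (intro integrable_continuous_real continuous_on_compose2[OF cont] continuous_intros)
             (use p in auto)
      qed (use R in auto)
      also have "integral {-R..0} (\<lambda>x. f (of_real x)) = integral {0..R} (\<lambda>x. f (- of_real x))"
        using Henstock_Kurzweil_Integration.integral_reflect_real[of R 0 "\<lambda>x. f (- of_real x)"] by simp
      also have "integral {0..R} (\<lambda>x. f (of_real x)) = (LINT x:{0..R}|lborel. f (of_real x))"
        by (subst set_borel_integral_eq_integral(2)[OF set_integrable_subset[OF int1]])
           auto
      also have "integral {0..R} (\<lambda>x. f (- of_real x)) = (LINT x:{0..R}|lborel. f (- of_real x))"
        by (subst set_borel_integral_eq_integral(2)[OF set_integrable_subset[OF int2]])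
           auto
      finally have AR: "A R - rs = - (contour_integral (linepath (Complex R 0) c) f
        + contour_integral (linepath c (Complex (-R) R)) f
        + contour_integral (linepath (Complex (-R) R) a) f)"
        by (simp add: A_def algebra_simps)
      have "norm (A R - rs) \<le> norm (contour_integral (linepath (Complex R 0) c) f)
        + norm (contour_integral (linepath c (Complex (-R) R)) f)
        + norm (contour_integral (linepath (Complex (-R) R) a) f)"
        unfolding AR norm_minus_cancel by (rule order_trans[OF norm_triangle_ineq add_right_mono[OF norm_triangle_ineq]])
      also have "\<dots> \<le> max C 0 / R\<^sup>2 * norm (c - Complex R 0) + max C 0 / R\<^sup>2 * norm (Complex (-R) R - c)
          + max C 0 / R\<^sup>2 * norm (a - Complex (-R) R)"
      proof -
        have side: "norm (contour_integral (linepath u v) f) \<le> max C 0 / R\<^sup>2 * norm (v - u)"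
          if uv: "\<And>z. z \<in> closed_segment u v \<Longrightarrow> z \<in> H \<and> norm z \<ge> R" for u v
        proof (rule norm_contour_integral_linepath_le)
          show "continuous_on (closed_segment u v) f"
          proof (rule continuous_on_subset[OF cont], rule subsetI)
            fix z assume "z \<in> closed_segment u v"
            then have "norm z \<ge> R" using uv by blast
            then have "z \<noteq> p" using R(3) by (metis not_le)
            then show "z \<in> UNIV - {p}" by simp
          qed
          show "norm (f z) \<le> max C 0 / R\<^sup>2" if "z \<in> closed_segment u v" for z
          proof -
            have z: "z \<in> H" "norm z \<ge> R" using uv[OF that] by auto
            then have "norm (f z) \<le> C / (norm z)\<^sup>2" using R by (intro bound) auto
            also have "\<dots> \<le> max C 0 / R\<^sup>2" using z R by (intro frac_le power_mono) auto
            finally show ?thesis .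
          qed
        qed auto
        have s1: "z \<in> H \<and> norm z \<ge> R" if "z \<in> closed_segment (Complex R 0) c" for z
          using that R abs_Re_le_cmod[of z] by (auto simp: H_def closed_segment_same_Re closed_segment_eq_real_ivl)
        have s2: "z \<in> H \<and> norm z \<ge> R" if "z \<in> closed_segment c (Complex (-R) R)" for z
          using that R abs_Im_le_cmod[of z] by (auto simp: H_def closed_segment_same_Im closed_segment_eq_real_ivl)
        have s3: "z \<in> H \<and> norm z \<ge> R" if "z \<in> closed_segment (Complex (-R) R) a" for z
          using that R abs_Re_le_cmod[of z] by (auto simp: H_def closed_segment_same_Re closed_segment_eq_real_ivl)
        show ?thesis by (rule add_mono[OF add_mono[OF side[OF s1] side[OF s2]] side[OF s3]])
      qed
      also have "\<dots> = 4 * R * (max C 0 / R\<^sup>2)"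
      proof -
        have "sqrt (4 * R\<^sup>2) = 2 * R" using R by (simp add: real_sqrt_mult)
        then show ?thesis using R by (simp add: a_c_def cmod_def add_divide_distrib[symmetric])
      qed
      finally show ?case .
    qed
  qed
  then have "(A \<longlongrightarrow> rs) at_top" by (simp add: LIM_zero_iff)
  with lim show ?thesis unfolding rs_def[symmetric] using tendsto_unique by force
qed

section \<open>The reflection formula\<close>

text \<open>The exponential constituents of \<open>mode\<close>. Unlike the cosine, each of them decays in one
  half-plane, so that contours can be moved.\<close>

definition oscillatory :: "real \<Rightarrow> complex \<Rightarrow> complex" where
  "oscillatory a y = (LINT x:{0..}|lborel. exp (\<i> * a * x) / (of_real x + y)\<^sup>2)"

lemma set_integrable_oscillatory:
  "y \<notin> \<real>\<^sub>\<le>\<^sub>0 \<Longrightarrow> set_integrable lborel {0..} (\<lambda>x. exp (\<i> * of_real a * of_real x) / (of_real x + y)\<^sup>2)"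
  using set_integrable_bounded_over_square[of y "\<lambda>x. exp (\<i> * of_real a * of_real x)" 1 0] by simp

lemma mode_eq_oscillatory:
  assumes "y \<notin> \<real>\<^sub>\<le>\<^sub>0"
  shows "mode a y = oscillatory 0 y - (oscillatory a y + oscillatory (-a) y) / 2"
proof -
  let ?e = "\<lambda>a x. exp (\<i> * of_real a * of_real x) / (of_real x + y)\<^sup>2"
  note I = set_integrable_oscillatory[OF assms]
  have "mode a y = (LINT x:{0..}|lborel. ?e 0 x - 1 / 2 * (?e a x + ?e (-a) x))"
    unfolding mode_def
    by (intro arg_cong[where f = "set_lebesgue_integral lborel {0..}"] ext)
       (simp add: cos_of_real[symmetric] cos_exp_eq diff_divide_distrib add_divide_distrib mult_ac)
  also have "\<dots> = oscillatory 0 y - (oscillatory a y + oscillatory (-a) y) / 2"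
    unfolding oscillatory_def
      set_integral_diff(2)[OF I set_integrable_mult_right[OF set_integral_add(1)[OF I I]]]
      set_integral_mult_right set_integral_add(2)[OF I I]
    by simp
  finally show ?thesis .
qed

text \<open>Replacing \<open>x\<close> by \<open>- x\<close> in the second integral gives the integral of one function over the
  whole line, whose only pole is the double pole \<open>- y\<close>.\<close>

lemma oscillatory_reflection:
  assumes a: "a \<ge> 0" and y: "Im y \<noteq> 0"
  shows "oscillatory a y + oscillatory (-a) (-y)
    = (if Im y > 0 then 0 else - 2 * pi * a * exp (- \<i> * a * y))"
proof -
  define f where "f = (\<lambda>z. exp (\<i> * of_real a * z) / (z + y)\<^sup>2)"
  have ny: "y \<notin> \<real>\<^sub>\<le>\<^sub>0" "-y \<notin> \<real>\<^sub>\<le>\<^sub>0" using y by (auto simp: complex_nonpos_Reals_iff)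
  have f_minus: "f (- of_real x) = exp (\<i> * of_real (-a) * of_real x) / (of_real x + - y)\<^sup>2" for x
    by (simp add: f_def power2_commute)
  have osc: "oscillatory a y = (LINT x:{0..}|lborel. f (of_real x))"
    "oscillatory (-a) (-y) = (LINT x:{0..}|lborel. f (- of_real x))"
    unfolding f_minus by (simp_all add: f_def oscillatory_def)
  have total: "(LINT x:{0..}|lborel. f (of_real x)) + (LINT x:{0..}|lborel. f (- of_real x))
     = (if Im (- y) > 0 then 2 * pi * \<i> * residue f (- y) else 0)"
  proof (rule upper_half_plane_residue)
    show "f holomorphic_on UNIV - {- y}"
      unfolding f_def by (intro holomorphic_intros) (auto simp: add_eq_0_iff2)
    show "set_integrable lborel {0..} (\<lambda>x. f (of_real x))"
      "set_integrable lborel {0..} (\<lambda>x. f (- of_real x))"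
      unfolding f_minus unfolding f_def by (intro set_integrable_oscillatory ny)+
    fix z assume z: "z \<in> {z. 0 \<le> Im z}" "norm z \<ge> 2 * norm y + 1"
    have "norm z - norm y \<le> norm (z + y)" by (rule norm_diff_ineq)
    then have "norm z / 2 \<le> norm (z + y)" "norm z > 0" using z norm_ge_zero[of y] by linarith+
    moreover have "norm (exp (\<i> * of_real a * z)) \<le> 1" using z a by simp
    ultimately have "norm (f z) \<le> 1 / (norm z / 2)\<^sup>2"
      unfolding f_def norm_divide norm_power by (intro frac_le power_mono) auto
    then show "norm (f z) \<le> 4 / (norm z)\<^sup>2" by (simp add: power_divide)
  qed (use y in auto)
  have res: "residue f (- y) = \<i> * a * exp (- \<i> * a * y)"
  proof -
    have "residue (\<lambda>z. exp (\<i> * of_real a * z) / (z - (- y)) ^ Suc 1) (- y)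
        = (deriv ^^ 1) (\<lambda>z. exp (\<i> * of_real a * z)) (- y) / fact 1"
      by (rule residue_holomorphic_over_power[of UNIV]) (auto intro!: holomorphic_intros)
    also have "(deriv ^^ 1) (\<lambda>z. exp (\<i> * of_real a * z)) (- y) = \<i> * a * exp (- \<i> * a * y)"
      by (auto intro!: DERIV_imp_deriv derivative_eq_intros)
    finally show ?thesis by (simp add: f_def numeral_2_eq_2)
  qed
  have rearrange: "2 * pi * \<i> * (\<i> * a * E) = - 2 * pi * a * E" for E :: complex
  proof -
    have "2 * pi * \<i> * (\<i> * a * E) = (\<i> * \<i>) * (2 * pi * a * E)" by (simp only: of_real_mult mult_ac)
    then show ?thesis by simp
  qed
  show ?thesis
  proof (cases "Im y > 0")
    case True
    then show ?thesis using total unfolding osc by simp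
  next
    case False
    then have "Im (- y) > 0" using y by simp
    then have "oscillatory a y + oscillatory (-a) (-y) = 2 * pi * \<i> * residue f (- y)"
      using total unfolding osc by presburger
    also have "\<dots> = - 2 * pi * a * exp (- \<i> * a * y)" unfolding res by (rule rearrange)
    finally show ?thesis using False by presburger
  qed
qed

text \<open>In \<open>mode a y + mode a (- y)\<close> three line integrals occur; for \<open>Im y > 0\<close> only the one with
  frequency \<open>- a\<close> meets the pole of the kernel.\<close>

lemma mode_reflection:
  assumes a: "a \<ge> 0" and y: "Im y > 0"
  shows "mode a y + mode a (-y) = pi * a * exp (\<i> * a * y)"
proof -
  have ny: "y \<notin> \<real>\<^sub>\<le>\<^sub>0" "-y \<notin> \<real>\<^sub>\<le>\<^sub>0" using y by (auto simp: complex_nonpos_Reals_iff)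
  have "oscillatory 0 y + oscillatory (-0) (-y) = 0"
    "oscillatory a y + oscillatory (-a) (-y) = 0"
    "oscillatory a (-y) + oscillatory (-a) (-(-y)) = - 2 * pi * a * exp (- \<i> * a * (-y))"
    using oscillatory_reflection[of 0 y] oscillatory_reflection[of a y] oscillatory_reflection[of a "-y"] a y
    by simp_all
  then have eqs: "oscillatory 0 (-y) = - oscillatory 0 y"
    "oscillatory (-a) (-y) = - oscillatory a y"
    "oscillatory a (-y) = - 2 * pi * a * exp (\<i> * a * y) - oscillatory (-a) y"
    by (simp_all add: add_eq_0_iff eq_diff_eq)
  show ?thesis
    unfolding mode_eq_oscillatory[OF ny(1)] mode_eq_oscillatory[OF ny(2)] eqs
    by (simp add: field_simps)
qed

text \<open>This is the origin of every wall-crossing factor: \<open>binet y\<close> and \<open>- binet (- y)\<close> are the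
  continuations of one integral from the two sides of the line \<open>Re y = 0\<close>, and their difference
  is the sum of the mode contributions \<open>q ^ k / k\<close>, with \<open>q = exp (2 \<pi> \<i> y)\<close>, that is
  \<open>- Ln (1 - q)\<close>.\<close>

lemma exp_binet_reflection:
  assumes y: "Im y > 0"
  shows "exp (binet y + binet (- y)) = inverse (1 - exp (2 * pi * \<i> * y))"
proof -
  define q where "q = exp (2 * pi * \<i> * y)"
  have ny: "y \<notin> \<real>\<^sub>\<le>\<^sub>0" "-y \<notin> \<real>\<^sub>\<le>\<^sub>0" using y by (auto simp: complex_nonpos_Reals_iff)
  have q: "norm q < 1" using y by (simp add: q_def)
  have "(\<lambda>k. of_real (1 / (2 * pi\<^sup>2 * (Suc k)\<^sup>2)) * mode (2 * pi * Suc k) y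
      + of_real (1 / (2 * pi\<^sup>2 * (Suc k)\<^sup>2)) * mode (2 * pi * Suc k) (-y)) sums (binet y + binet (- y))"
    by (intro sums_add modes_sums_binet ny)
  moreover have "of_real (1 / (2 * pi\<^sup>2 * (Suc k)\<^sup>2)) * mode (2 * pi * Suc k) y
      + of_real (1 / (2 * pi\<^sup>2 * (Suc k)\<^sup>2)) * mode (2 * pi * Suc k) (-y) = q ^ Suc k / of_nat (Suc k)" for k
  proof -
    have "exp (\<i> * of_real (2 * pi * real (Suc k)) * y) = q ^ Suc k"
      unfolding q_def exp_of_nat_mult[symmetric] by (simp add: mult_ac)
    then show ?thesis
      unfolding distrib_left[symmetric] using mode_reflection[of "2 * pi * Suc k" y] y
      by (simp add: field_simps power2_eq_square del: of_nat_Suc mult_Suc mult_Suc_right)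
  qed
  ultimately have 1: "(\<lambda>k. q ^ Suc k / of_nat (Suc k)) sums (binet y + binet (- y))" by simp
  have "(\<lambda>n. - ((- (- q)) ^ n) / of_nat n) sums Ln (1 + - q)"
    by (rule Ln_series') (use q in simp)
  then have "(\<lambda>n. - ((- (- q)) ^ Suc n) / of_nat (Suc n)) sums (Ln (1 + - q) - 0)"
    by (subst sums_Suc_iff) simp
  from sums_minus[OF this] have "(\<lambda>k. q ^ Suc k / of_nat (Suc k)) sums (- Ln (1 - q))" by simp
  with 1 have "binet y + binet (- y) = - Ln (1 - q)" by (rule sums_unique2)
  moreover have "1 - q \<noteq> 0" using q by auto
  ultimately show ?thesis by (simp add: exp_minus q_def)
qed

section \<open>Binet's second integral\<close>

lemma rotated_points_not_nonpos:
  assumes "Re y > 0" shows "\<i> * y \<notin> \<real>\<^sub>\<le>\<^sub>0" "- \<i> * y \<notin> \<real>\<^sub>\<le>\<^sub>0" "y \<notin> \<real>\<^sub>\<le>\<^sub>0" "cnj y \<notin> \<real>\<^sub>\<le>\<^sub>0"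
  using assms by (auto simp: complex_nonpos_Reals_iff)

text \<open>For \<open>Re y > 0\<close> the pole \<open>- y\<close> is outside the first quadrant, into which
  \<open>exp (\<i> a x)\<close> decays; the contour turns from the positive to the imaginary axis.\<close>

lemma oscillatory_rotated:
  assumes a: "a \<ge> 0" and y: "Re y > 0"
  shows "oscillatory a y = - \<i> * (LINT s:{0..}|lborel. of_real (exp (- a * s)) / (of_real s + - \<i> * y)\<^sup>2)"
proof -
  define f where "f = (\<lambda>z. exp (\<i> * of_real a * z) / (z + y)\<^sup>2)"
  note ny = rotated_points_not_nonpos[OF y]
  have f_imag: "f (\<i> * of_real s) = - 1 * (of_real (exp (- a * s)) / (of_real s + - \<i> * y)\<^sup>2)" for s
  proof -
    have "\<i> * of_real s + y = \<i> * (of_real s + - \<i> * y)" by (simp add: algebra_simps)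
    then have sq: "(\<i> * of_real s + y)\<^sup>2 = - ((of_real s + - \<i> * y)\<^sup>2)" by (simp add: power_mult_distrib)
    have ex: "exp (\<i> * of_real a * (\<i> * of_real s)) = of_real (exp (- a * s))"
    proof -
      have "\<i> * of_real a * (\<i> * of_real s) = (\<i> * \<i>) * (of_real a * of_real s)" by (simp only: mult_ac)
      then show ?thesis by (simp add: exp_of_real[symmetric])
    qed
    show ?thesis unfolding f_def sq ex by simp
  qed
  have i1: "set_integrable lborel {0..} (\<lambda>x. f (of_real x))"
    unfolding f_def by (rule set_integrable_oscillatory[OF ny(3)])
  have i2: "set_integrable lborel {0..} (\<lambda>x. complex_of_real (exp (- a * x)) / (of_real x + - \<i> * y)\<^sup>2)"
    using set_integrable_bounded_over_square[OF ny(2), of "\<lambda>x. of_real (exp (- a * x))" 1 0] a by simp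
  have "oscillatory a y = (LINT x:{0..}|lborel. f (of_real x))"
    by (simp add: oscillatory_def f_def)
  also have "\<dots> = \<i> * (LINT x:{0..}|lborel. f (\<i> * of_real x))"
  proof (rule rotate_half_line)
    have "z + y \<noteq> 0" if "Re z \<ge> 0" for z
      using y that by (auto simp: complex_eq_iff)
    then show "f holomorphic_on {z. 0 \<le> Re z \<and> 0 \<le> Im z}"
      unfolding f_def by (intro holomorphic_intros) auto
    show "set_integrable lborel {0..} (\<lambda>x. f (of_real x))" by (rule i1)
    show "set_integrable lborel {0..} (\<lambda>x. f (\<i> * of_real x))"
      unfolding f_imag by (intro set_integrable_mult_right i2)
    fix z assume z: "z \<in> {z. 0 \<le> Re z \<and> 0 \<le> Im z}" "norm z \<ge> 2 * norm y + 1"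
    have "norm z - norm y \<le> norm (z + y)" by (rule norm_diff_ineq)
    then have "norm z / 2 \<le> norm (z + y)" "norm z > 0" using z norm_ge_zero[of y] by linarith+
    moreover have "norm (exp (\<i> * of_real a * z)) \<le> 1" using z a by simp
    ultimately have "norm (f z) \<le> 1 / (norm z / 2)\<^sup>2"
      unfolding f_def norm_divide norm_power by (intro frac_le power_mono) auto
    then show "norm (f z) \<le> 4 / (norm z)\<^sup>2" by (simp add: power_divide)
  qed
  also have "\<dots> = - \<i> * (LINT s:{0..}|lborel. of_real (exp (- a * s)) / (of_real s + - \<i> * y)\<^sup>2)"
    unfolding f_imag set_integral_mult_right by simp
  finally show ?thesis .
qed

lemma oscillatory_cnj: "oscillatory (- a) y = cnj (oscillatory a (cnj y))"
  unfolding oscillatory_def set_lebesgue_integral_def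
  by (subst Bochner_Integration.integral_cnj[symmetric], intro Bochner_Integration.integral_cong) (auto simp: exp_cnj)

text \<open>The same rotation into the fourth quadrant, obtained by complex conjugation.\<close>

lemma oscillatory_rotated':
  assumes a: "a \<ge> 0" and y: "Re y > 0"
  shows "oscillatory (- a) y = \<i> * (LINT s:{0..}|lborel. of_real (exp (- a * s)) / (of_real s + \<i> * y)\<^sup>2)"
proof -
  have "oscillatory (- a) y = cnj (- \<i> * (LINT s:{0..}|lborel. of_real (exp (- a * s)) / (of_real s + - \<i> * cnj y)\<^sup>2))"
    unfolding oscillatory_cnj by (subst oscillatory_rotated) (use a y in auto)
  also have "\<dots> = \<i> * cnj (LINT s:{0..}|lborel. of_real (exp (- a * s)) / (of_real s + - \<i> * cnj y)\<^sup>2)"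
    by simp
  also have "cnj (LINT s:{0..}|lborel. of_real (exp (- a * s)) / (of_real s + - \<i> * cnj y)\<^sup>2)
     = (LINT s:{0..}|lborel. of_real (exp (- a * s)) / (of_real s + \<i> * y)\<^sup>2)"
    unfolding set_lebesgue_integral_def
    by (subst Bochner_Integration.integral_cnj[symmetric], intro Bochner_Integration.integral_cong) auto
  finally show ?thesis .
qed

text \<open>The kernel is \<open>y / ((s + \<i> y) (s - \<i> y))\<close>, and for \<open>Re y > 0\<close> neither \<open>\<i> y\<close> nor
  \<open>- \<i> y\<close> lies on the slit.\<close>

lemma Poisson_kernel_bound:
  assumes y: "Re y > 0"
  obtains C where "C \<ge> 0" "\<And>s. s \<ge> 0 \<Longrightarrow> norm (y / (y\<^sup>2 + (of_real s)\<^sup>2)) \<le> C / (s + 1) ^ 2"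
proof -
  note ny = rotated_points_not_nonpos[OF y]
  obtain c1 where c1: "c1 > 0" "\<And>x. x \<ge> 0 \<Longrightarrow> c1 * (x + 1) \<le> cmod (of_real x + \<i> * y)"
    using slit_plane_distance[OF ny(1)] by metis
  obtain c2 where c2: "c2 > 0" "\<And>x. x \<ge> 0 \<Longrightarrow> c2 * (x + 1) \<le> cmod (of_real x + - \<i> * y)"
    using slit_plane_distance[OF ny(2)] by metis
  show ?thesis
  proof (rule that[of "norm y / (c1 * c2)"])
    show "norm (y / (y\<^sup>2 + (of_real s)\<^sup>2)) \<le> norm y / (c1 * c2) / (s + 1)\<^sup>2" if s: "s \<ge> 0" for s
    proof -
      have "y\<^sup>2 + (of_real s)\<^sup>2 = (of_real s + \<i> * y) * (of_real s + - \<i> * y)"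
        by (simp add: algebra_simps power2_eq_square)
      then have "norm (y / (y\<^sup>2 + (of_real s)\<^sup>2)) = norm y / (norm (of_real s + \<i> * y) * norm (of_real s + - \<i> * y))"
        by (simp only: norm_divide norm_mult)
      also have "\<dots> \<le> norm y / ((c1 * (s + 1)) * (c2 * (s + 1)))"
      proof -
        have p: "0 < c1 * (s + 1)" "0 < c2 * (s + 1)" using c1(1) c2(1) s by auto
        note n = less_le_trans[OF p(1) c1(2)[OF s]] less_le_trans[OF p(2) c2(2)[OF s]]
        show ?thesis
          by (intro divide_left_mono mult_mono mult_pos_pos c1(2)[OF s] c2(2)[OF s] n p norm_ge_zero
              order.strict_implies_order[OF p(2)])
      qed
      finally show ?thesis by (simp add: power2_eq_square mult_ac)
    qed
  qed (use c1 c2 in auto)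
qed

lemma set_integrable_Poisson:
  fixes g :: "real \<Rightarrow> complex"
  assumes y: "Re y > 0" and [measurable]: "g \<in> borel_measurable borel"
    and M: "\<And>x. x \<ge> 0 \<Longrightarrow> norm (g x) \<le> M"
  shows "set_integrable lborel {0..} (\<lambda>s. g s * (y / (y\<^sup>2 + (of_real s)\<^sup>2)))"
proof -
  obtain C where C: "C \<ge> 0" "\<And>s. s \<ge> 0 \<Longrightarrow> norm (y / (y\<^sup>2 + (of_real s)\<^sup>2)) \<le> C / (s + 1) ^ 2"
    using Poisson_kernel_bound[OF y] by metis
  have "set_integrable lborel {0..} (\<lambda>x. M * C * (1 / (x + 1) ^ (0 + 2)))"
    by (intro set_integrable_mult_right integral_inverse_power) auto
  then show ?thesis
  proof (rule set_integrable_bound)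
    show "AE x in lborel. x \<in> {0..} \<longrightarrow> norm (g x * (y / (y\<^sup>2 + (of_real x)\<^sup>2))) \<le> norm (M * C * (1 / (x + 1) ^ (0 + 2)))"
    proof (intro AE_I2 impI)
      fix x :: real assume "x \<in> {0..}"
      then have x: "x \<ge> 0" by simp
      have "M \<ge> 0" using order_trans[OF norm_ge_zero M[OF x]] .
      then show "norm (g x * (y / (y\<^sup>2 + (of_real x)\<^sup>2))) \<le> norm (M * C * (1 / (x + 1) ^ (0 + 2)))"
        unfolding norm_mult[of "g x"] using mult_mono[OF M[OF x] C(2)[OF x]] C(1) x by (simp add: power2_eq_square)
    qed
  qed (auto simp: set_borel_measurable_def)
qed

text \<open>After rotating both exponentials, the kernel
  \<open>\<i> / 2 (1 / (s + \<i> y)\<^sup>2 - 1 / (s - \<i> y)\<^sup>2)\<close> is minus the derivative of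
  \<open>y / (y\<^sup>2 + s\<^sup>2)\<close>, and an integration by parts turns it into the kernel of Binet's second
  integral.\<close>

lemma mode_eq_Poisson:
  assumes a: "a \<ge> 0" and y: "Re y > 0"
  shows "mode a y = a * (LINT s:{0..}|lborel. of_real (exp (- a * s)) * (y / (y\<^sup>2 + (of_real s)\<^sup>2)))"
proof -
  note ny = rotated_points_not_nonpos[OF y]
  let ?e = "\<lambda>s. complex_of_real (exp (- a * s))"
  let ?P = "\<lambda>s. y / (y\<^sup>2 + (complex_of_real s)\<^sup>2)"
  let ?A = "\<lambda>s. (1 - ?e s) / (complex_of_real s + - \<i> * y)\<^sup>2"
  let ?B = "\<lambda>s. (1 - ?e s) / (complex_of_real s + \<i> * y)\<^sup>2"
  have e_le: "norm (?e s) \<le> 1" if "s \<ge> 0" for s using that a by simp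
  have e1_le: "norm (1 - ?e s) \<le> 2" if "s \<ge> 0" for s
    using norm_triangle_ineq4[of 1 "?e s"] e_le[OF that] unfolding norm_one by linarith
  have I: "set_integrable lborel {0..} (\<lambda>s. ?e s / (of_real s + w)\<^sup>2)"
    "set_integrable lborel {0..} (\<lambda>s. 1 / (of_real s + w)\<^sup>2)" "set_integrable lborel {0..} (\<lambda>s. (1 - ?e s) / (of_real s + w)\<^sup>2)"
    if "w \<notin> \<real>\<^sub>\<le>\<^sub>0" for w :: complex
    using set_integrable_bounded_over_square[OF that, of "?e" 1 0]
      set_integrable_bounded_over_square[OF that, of "\<lambda>_. 1" 1 0]
      set_integrable_bounded_over_square[OF that, of "\<lambda>s. 1 - ?e s" 2 0] e_le e1_le by simp_all
  have IP: "set_integrable lborel {0..} (\<lambda>s. a * (?e s * ?P s))"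
    by (intro set_integrable_mult_right set_integrable_Poisson[OF y, of _ 1]) (use e_le in auto)
  have split: "(LINT s:{0..}|lborel. (1 - ?e s) / (of_real s + w)\<^sup>2) =
      (LINT s:{0..}|lborel. 1 / (of_real s + w)\<^sup>2) - (LINT s:{0..}|lborel. ?e s / (of_real s + w)\<^sup>2)"
    if "w \<notin> \<real>\<^sub>\<le>\<^sub>0" for w
    unfolding diff_divide_distrib by (rule set_integral_diff(2)[OF I(2) I(1)]) (rule that)+
  have o0: "oscillatory 0 y = - \<i> * (LINT s:{0..}|lborel. 1 / (of_real s + - \<i> * y)\<^sup>2)"
    "oscillatory 0 y = \<i> * (LINT s:{0..}|lborel. 1 / (of_real s + \<i> * y)\<^sup>2)"
    using oscillatory_rotated[of 0 y] oscillatory_rotated'[of 0 y] y by simp_all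
  have "mode a y = (oscillatory 0 y - oscillatory a y) / 2 + (oscillatory 0 y - oscillatory (-a) y) / 2"
    unfolding mode_eq_oscillatory[OF ny(3)] by (simp add: field_simps)
  also have "oscillatory 0 y - oscillatory a y = - \<i> * (LINT s:{0..}|lborel. ?A s)"
    unfolding split[OF ny(2)] o0(1) oscillatory_rotated[OF a y] by (simp only: right_diff_distrib)
  also have "oscillatory 0 y - oscillatory (-a) y = \<i> * (LINT s:{0..}|lborel. ?B s)"
    unfolding split[OF ny(1)] o0(2) oscillatory_rotated'[OF a y] by (simp only: right_diff_distrib)
  finally have m: "mode a y = (LINT s:{0..}|lborel. \<i> / 2 * (?B s - ?A s))"
    unfolding set_integral_mult_right set_integral_diff(2)[OF I(3)[OF ny(1)] I(3)[OF ny(2)]]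
    by (simp add: algebra_simps)
  \<comment> \<open>the boundary term of the integration by parts; it vanishes at \<open>0\<close> and at infinity\<close>
  define F where "F = (\<lambda>s. - (1 - ?e s) * ?P s)"
  define F' where "F' = (\<lambda>s. \<i> / 2 * (?B s - ?A s) - a * (?e s * ?P s))"
  have nz: "complex_of_real s + \<i> * y \<noteq> 0" "complex_of_real s + - \<i> * y \<noteq> 0" for s
    using y by (auto simp: complex_eq_iff)
  have P_eq: "?P s = - \<i> / 2 * (1 / (of_real s + - \<i> * y) - 1 / (of_real s + \<i> * y))" for s
  proof -
    have "y\<^sup>2 + (of_real s)\<^sup>2 = (of_real s + \<i> * y) * (of_real s + - \<i> * y)"
      by (simp add: algebra_simps power2_eq_square)
    then show ?thesis using nz[of s] by (simp add: divide_simps)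
  qed
  have int_F': "set_integrable lborel {0..} F'"
    unfolding F'_def by (intro set_integral_diff(1) set_integrable_mult_right I ny IP)
  have "(LINT s:{0..}|lborel. F' s) = 0 - F 0"
  proof (rule set_integral_FTC_at_top[OF _ _ int_F'])
    fix s :: real
    have dE: "(?e has_vector_derivative (- a * ?e s)) (at s)"
    proof -
      have "((\<lambda>s. exp (- a * s)) has_real_derivative - a * exp (- a * s)) (at s)"
        by (auto intro!: derivative_eq_intros)
      from has_vector_derivative_of_real[OF this] show ?thesis by simp
    qed
    have dq: "((\<lambda>s. 1 / (of_real s + w)) has_vector_derivative (- 1 / (of_real s + w)\<^sup>2)) (at s)"
      if "of_real s + w \<noteq> 0" for w :: complex
    proof -
      have "((\<lambda>z. 1 / (z + w)) has_field_derivative (- 1 / (of_real s + w)\<^sup>2)) (at (of_real s))"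
        using that by (auto intro!: derivative_eq_intros simp: power2_eq_square divide_inverse)
      then show ?thesis by (rule has_vector_derivative_real_field)
    qed
    have "(F has_vector_derivative
       (- (1 - ?e s)) * (- \<i> / 2 * (- 1 / (of_real s + - \<i> * y)\<^sup>2 - (- 1 / (of_real s + \<i> * y)\<^sup>2)))
        + (- a * ?e s) * (- \<i> / 2 * (1 / (of_real s + - \<i> * y) - 1 / (of_real s + \<i> * y)))) (at s)"
      unfolding F_def P_eq
      by (intro has_vector_derivative_mult has_vector_derivative_mult_right has_vector_derivative_diff dq nz)
         (use has_vector_derivative_diff[OF dE has_vector_derivative_const[of 1]] in simp)
    moreover have "(- (1 - ?e s)) * (- \<i> / 2 * (- 1 / (of_real s + - \<i> * y)\<^sup>2 - (- 1 / (of_real s + \<i> * y)\<^sup>2)))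
        + (- a * ?e s) * (- \<i> / 2 * (1 / (of_real s + - \<i> * y) - 1 / (of_real s + \<i> * y))) = F' s"
      unfolding F'_def P_eq by (simp add: algebra_simps diff_divide_distrib)
    ultimately show "(F has_vector_derivative F' s) (at s)" by simp
  next
    show "continuous_on {0..} F'" unfolding F'_def P_eq
      by (intro continuous_intros) (use nz in auto)
    obtain C where C: "C \<ge> 0" "\<And>s. s \<ge> 0 \<Longrightarrow> norm (?P s) \<le> C / (s + 1) ^ 2"
      using Poisson_kernel_bound[OF y] by metis
    show "(F \<longlongrightarrow> 0) at_top"
    proof (rule Lim_null_comparison)
      show "((\<lambda>s. 2 * (C / (s + 1) ^ 2)) \<longlongrightarrow> 0) at_top" by real_asymp
      show "\<forall>\<^sub>F s in at_top. norm (F s) \<le> 2 * (C / (s + 1) ^ 2)"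
        using eventually_ge_at_top[of 0]
      proof eventually_elim
        case (elim s)
        show ?case unfolding F_def norm_mult norm_minus_cancel
          by (intro mult_mono e1_le C elim) auto
      qed
    qed
  qed
  also have "F 0 = 0" by (simp add: F_def)
  finally have "(LINT s:{0..}|lborel. F' s) = 0" by simp
  moreover have "(LINT s:{0..}|lborel. F' s) = (LINT s:{0..}|lborel. \<i> / 2 * (?B s - ?A s)) - (LINT s:{0..}|lborel. a * (?e s * ?P s))"
    unfolding F'_def
    by (rule set_integral_diff(2)[OF _ IP]) (intro set_integral_diff(1) set_integrable_mult_right I ny)
  ultimately show ?thesis unfolding m set_integral_mult_right by simp
qed

lemma integral_exp_decay:
  fixes b :: real
  assumes b: "b > 0"
  shows "set_integrable lborel {0..} (\<lambda>x. exp (- b * x))" "(LINT x:{0..}|lborel. exp (- b * x)) = 1 / b"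
proof -
  have "has_bochner_integral lborel (\<lambda>x. indicator {0..} x *\<^sub>R exp (- b * x)) (1 / b)"
  proof (rule has_bochner_integral_nn_integral)
    have "(\<integral>\<^sup>+x. ennreal (exp (- b * x)) * indicator {0..} x \<partial>lborel) = 0 - (- exp (- b * 0) / b)"
    proof (rule nn_integral_FTC_atLeast)
      show "((\<lambda>x. - exp (- b * x) / b) \<longlongrightarrow> 0) at_top" using b by real_asymp
    qed (use b in \<open>auto intro!: derivative_eq_intros\<close>)
    moreover have "(\<integral>\<^sup>+x. ennreal (indicator {0..} x *\<^sub>R exp (- b * x)) \<partial>lborel)
       = (\<integral>\<^sup>+x. ennreal (exp (- b * x)) * indicator {0..} x \<partial>lborel)"
      by (intro nn_integral_cong) (auto simp: indicator_def)
    ultimately show "(\<integral>\<^sup>+x. ennreal (indicator {0..} x *\<^sub>R exp (- b * x)) \<partial>lborel) = ennreal (1 / b)" by simp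
  qed (use b in \<open>auto simp: indicator_def\<close>)
  then show "set_integrable lborel {0..} (\<lambda>x. exp (- b * x))" "(LINT x:{0..}|lborel. exp (- b * x)) = 1 / b"
    by (auto simp: set_integrable_def set_lebesgue_integral_def has_bochner_integral_iff)
qed

lemma minus_ln_one_minus_sums:
  fixes q :: real assumes "0 \<le> q" "q < 1"
  shows "(\<lambda>k. q ^ Suc k / real (Suc k)) sums (- ln (1 - q))"
proof -
  have "(\<lambda>n. - ((- (- q)) ^ n) / of_nat n) sums ln (1 + - q)"
    by (rule ln_series') (use assms in simp)
  then have "(\<lambda>n. - ((- (- q)) ^ Suc n) / of_nat (Suc n)) sums (ln (1 + - q) - 0)"
    by (subst sums_Suc_iff) simp
  from sums_minus[OF this] show ?thesis by simp
qed

text \<open>Binet's second formula: summing the modes \<open>exp (- 2 \<pi> k s) / k\<close> under the integral produces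
  \<open>- ln (1 - exp (- 2 \<pi> s))\<close>.\<close>

lemma binet_second_integral:
  fixes y :: complex
  assumes y: "Re y > 0"
  shows "set_integrable lborel {0<..} (\<lambda>s. of_real (ln (1 - exp (- 2 * pi * s))) * (y / (y\<^sup>2 + (of_real s)\<^sup>2)))"
    and "binet y = - (1 / pi) * (LINT s:{0<..}|lborel. of_real (ln (1 - exp (- 2 * pi * s))) * (y / (y\<^sup>2 + (of_real s)\<^sup>2)))"
proof -
  note ny = rotated_points_not_nonpos[OF y]
  obtain C where C: "C \<ge> 0" "\<And>s. s \<ge> 0 \<Longrightarrow> norm (y / (y\<^sup>2 + (of_real s)\<^sup>2)) \<le> C / (s + 1) ^ 2"
    using Poisson_kernel_bound[OF y] by metis
  let ?P = "\<lambda>s. y / (y\<^sup>2 + (complex_of_real s)\<^sup>2)"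
  define b where "b = (\<lambda>k. 2 * pi * real (Suc k))"
  have b: "b k > 0" for k by (simp add: b_def)
  let ?g = "\<lambda>k s. of_real (exp (- b k * s)) * ?P s"
  have int_g: "set_integrable lborel {0..} (?g k)" for k
  proof (rule set_integrable_Poisson[OF y, of _ 1])
    fix s :: real assume "s \<ge> 0"
    then show "norm (complex_of_real (exp (- b k * s))) \<le> 1" using b[of k] by simp
  qed simp
  have P_le: "norm (?P s) \<le> C" if "s \<ge> 0" for s
  proof -
    have "C / (s + 1) ^ 2 \<le> C / 1" using that C(1) by (intro divide_left_mono) auto
    with C(2)[OF that] show ?thesis by simp
  qed
  have int_norm: "(LINT s:{0..}|lborel. norm (?g k s)) \<le> C / b k" for k
  proof -
    have "(LINT s:{0..}|lborel. norm (?g k s)) \<le> (LINT s:{0..}|lborel. C * exp (- b k * s))"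
    proof (rule set_integral_mono)
      show "set_integrable lborel {0..} (\<lambda>s. norm (?g k s))" by (rule set_integrable_norm[OF int_g])
      show "set_integrable lborel {0..} (\<lambda>s. C * exp (- b k * s))"
        by (intro set_integrable_mult_right integral_exp_decay b)
      show "norm (?g k s) \<le> C * exp (- b k * s)" if "s \<in> {0..}" for s
        unfolding norm_mult[of "of_real _"] using P_le[of s] that
        by (simp add: mult.commute[of C] mult_left_mono)
    qed
    also have "\<dots> = C / b k" unfolding set_integral_mult_right integral_exp_decay(2)[OF b] by simp
    finally show ?thesis .
  qed
  let ?h = "\<lambda>k s. indicator {0<..} s *\<^sub>R (1 / real (Suc k)) *\<^sub>R ?g k s"
  have int_h: "integrable lborel (?h k)" for k
  proof -
    have "set_integrable lborel {0<..} (?g k)" by (rule set_integrable_subset[OF int_g]) auto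
    then have "integrable lborel (\<lambda>s. (1 / real (Suc k)) *\<^sub>R indicator {0<..} s *\<^sub>R ?g k s)"
      unfolding set_integrable_def by (rule integrable_scaleR_right)
    then show ?thesis by (simp add: mult_ac scaleR_conv_of_real del: of_nat_Suc)
  qed
  have open_closed: "(LINT s:{0<..}|lborel. f s) = (LINT s:{0..}|lborel. f s)"
    if [measurable]: "f \<in> borel_measurable borel" for f :: "real \<Rightarrow> 'b :: {banach, second_countable_topology}"
    unfolding set_lebesgue_integral_def
    by (intro integral_cong_AE eventually_mono[OF AE_lborel_singleton[of 0]]) (auto simp: indicator_def)
  have sum_h: "(\<lambda>k. ?h k s) sums (indicator {0<..} s *\<^sub>R (of_real (- ln (1 - exp (- 2 * pi * s))) * ?P s))" for s
  proof (cases "s > 0")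
    case True
    have "(\<lambda>k. exp (- 2 * pi * s) ^ Suc k / real (Suc k)) sums - ln (1 - exp (- 2 * pi * s))"
      by (rule minus_ln_one_minus_sums) (use True in auto)
    then have "(\<lambda>k. complex_of_real (exp (- 2 * pi * s) ^ Suc k / real (Suc k)) * ?P s) sums (of_real (- ln (1 - exp (- 2 * pi * s))) * ?P s)"
      by (intro sums_mult2 sums_of_real)
    moreover have "exp (- 2 * pi * s) ^ Suc k = exp (- b k * s)" for k
      unfolding exp_of_nat_mult[symmetric] by (simp add: b_def mult_ac)
    ultimately have "(\<lambda>k. complex_of_real (exp (- b k * s) / real (Suc k)) * ?P s) sums (of_real (- ln (1 - exp (- 2 * pi * s))) * ?P s)"
      by (simp only:)
    then show ?thesis using True by (simp add: scaleR_conv_of_real mult_ac del: of_nat_Suc)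
  qed simp
  have summ: "summable (\<lambda>k. norm (?h k s))" for s
  proof (cases "s > 0")
    case True
    have "summable (\<lambda>k. norm (?P s) * (exp (- 2 * pi * s) ^ Suc k / real (Suc k)))"
      by (intro summable_mult sums_summable[OF minus_ln_one_minus_sums]) (use True in auto)
    moreover have "exp (- 2 * pi * s) ^ Suc k = exp (- b k * s)" for k
      unfolding exp_of_nat_mult[symmetric] by (simp add: b_def mult_ac)
    ultimately have "summable (\<lambda>k. norm (?P s) * (exp (- b k * s) / real (Suc k)))"
      by (simp only:)
    moreover have "norm (?h k s) = norm (?P s) * (exp (- b k * s) / real (Suc k))" for k
      unfolding norm_scaleR norm_mult[of "of_real _"] using True by (simp add: mult_ac del: of_nat_Suc)
    ultimately show ?thesis by (simp only:)
  qed simp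
  have norm_h: "summable (\<lambda>k. LINT s|lborel. norm (?h k s))"
  proof (rule summable_comparison_test'[OF summable_over_squares, of 0])
    fix k :: nat
    have nonneg: "0 \<le> (LINT s|lborel. norm (?h k s))"
      by (rule Bochner_Integration.integral_nonneg) simp
    have "(LINT s|lborel. norm (?h k s)) = (LINT s:{0<..}|lborel. 1 / real (Suc k) * norm (?g k s))"
      by (simp add: set_lebesgue_integral_def mult_ac del: of_nat_Suc)
    also have "\<dots> = 1 / real (Suc k) * (LINT s:{0..}|lborel. norm (?g k s))"
      unfolding set_integral_mult_right by (subst open_closed) auto
    also have "\<dots> \<le> 1 / real (Suc k) * (C / b k)"
      by (intro mult_left_mono int_norm) simp
    also have "\<dots> = (C / (2 * pi)) / (real (Suc k))\<^sup>2"
      by (simp add: b_def power2_eq_square del: of_nat_Suc)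
    finally show "norm (LINT s|lborel. norm (?h k s)) \<le> (C / (2 * pi)) / (real (Suc k))\<^sup>2"
      using nonneg by (simp only: real_norm_def abs_of_nonneg)
  qed
  have sum_h': "(\<Sum>k. ?h k s) = indicator {0<..} s *\<^sub>R (of_real (- ln (1 - exp (- 2 * pi * s))) * ?P s)" for s
    using sum_h[of s] by (rule sums_unique[symmetric])
  have "integrable lborel (\<lambda>s. (\<Sum>k. ?h k s))"
    by (rule integrable_suminf[OF int_h _ norm_h]) (use summ in auto)
  then have int: "set_integrable lborel {0<..} (\<lambda>s. of_real (- ln (1 - exp (- 2 * pi * s))) * ?P s)"
    unfolding sum_h' set_integrable_def .
  from set_integrable_mult_right[OF this, of "-1"]
  show "set_integrable lborel {0<..} (\<lambda>s. of_real (ln (1 - exp (- 2 * pi * s))) * ?P s)" by simp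
  have "(\<lambda>k. integral\<^sup>L lborel (?h k)) sums (LINT s|lborel. (\<Sum>k. ?h k s))"
    by (rule sums_integral[OF int_h _ norm_h]) (use summ in auto)
  then have "(\<lambda>k. (1 / pi) * integral\<^sup>L lborel (?h k)) sums ((1 / pi) * (LINT s|lborel. (\<Sum>k. ?h k s)))"
    by (rule sums_mult)
  moreover have "(1 / pi) * integral\<^sup>L lborel (?h k) = of_real (1 / (2 * pi\<^sup>2 * (Suc k)\<^sup>2)) * mode (b k) y" for k
  proof -
    have "integral\<^sup>L lborel (?h k) = (LINT s:{0<..}|lborel. of_real (1 / real (Suc k)) * ?g k s)"
      by (simp add: set_lebesgue_integral_def scaleR_conv_of_real del: of_nat_Suc)
    also have "\<dots> = of_real (1 / real (Suc k)) * (LINT s:{0..}|lborel. ?g k s)"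
      unfolding set_integral_mult_right by (subst open_closed) auto
    finally have m1: "(1 / pi) * integral\<^sup>L lborel (?h k) = of_real (1 / (pi * real (Suc k))) * (LINT s:{0..}|lborel. ?g k s)"
      by (simp del: of_nat_Suc)
    have m2: "of_real (1 / (2 * pi\<^sup>2 * (Suc k)\<^sup>2)) * mode (b k) y
        = of_real (1 / (2 * pi\<^sup>2 * (Suc k)\<^sup>2) * b k) * (LINT s:{0..}|lborel. ?g k s)"
      using mode_eq_Poisson[of "b k" y] b[of k] y by (simp only: of_real_mult mult.assoc less_imp_le)
    have m3: "1 / (2 * pi\<^sup>2 * (Suc k)\<^sup>2) * b k = 1 / (pi * real (Suc k))"
      by (simp add: b_def power2_eq_square del: of_nat_Suc mult_Suc mult_Suc_right)
    show ?thesis by (simp only: m1 m2 m3)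
  qed
  ultimately have "binet y = (1 / pi) * (LINT s|lborel. (\<Sum>k. ?h k s))"
    using modes_sums_binet[OF ny(3)] unfolding b_def by (simp add: sums_iff)
  also have "(LINT s|lborel. (\<Sum>k. ?h k s)) = (LINT s:{0<..}|lborel. - 1 * (of_real (ln (1 - exp (- 2 * pi * s))) * ?P s))"
    unfolding sum_h' set_lebesgue_integral_def by simp
  also have "\<dots> = - 1 * (LINT s:{0<..}|lborel. (of_real (ln (1 - exp (- 2 * pi * s))) * ?P s))"
    by (rule set_integral_mult_right)
  finally show "binet y = - (1 / pi) * (LINT s:{0<..}|lborel. of_real (ln (1 - exp (- 2 * pi * s))) * ?P s)"
    by simp
qed

section \<open>The integrals along the BPS rays\<close>

text \<open>The change of variables \<open>s \<mapsto> 1 / s\<close> of the half-line. Integrability is required on one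
  side only and transported to the other; this is why the absolute-integrability version of the
  substitution rule is used, applied to real and imaginary parts.\<close>

lemma set_integral_inverse_substitution:
  fixes K :: "real \<Rightarrow> complex"
  assumes K: "set_integrable lborel {0<..} K" and [measurable]: "K \<in> borel_measurable borel"
  shows "(LINT s:{0<..}|lborel. of_real (1 / s\<^sup>2) * K (1 / s)) = (LINT s:{0<..}|lborel. K s)"
proof -
  have image: "(\<lambda>s::real. 1 / s) ` {0<..} = {0<..}"
  proof -
    have "s \<in> (\<lambda>s::real. 1 / s) ` {0<..}" if "s > 0" for s
      using that by (intro image_eqI[of _ _ "1 / s"]) auto
    then show ?thesis by auto
  qed
  have real: "set_integrable lborel {0<..} (\<lambda>s. 1 / s\<^sup>2 * f (1 / s)) \<and>
      (LINT s:{0<..}|lborel. 1 / s\<^sup>2 * f (1 / s)) = (LINT s:{0<..}|lborel. f s)"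
    if f: "set_integrable lborel {0<..} f" and [measurable]: "f \<in> borel_measurable borel" for f :: "real \<Rightarrow> real"
  proof -
    have leb: "g absolutely_integrable_on {0<..} \<longleftrightarrow> set_integrable lborel {0<..} g"
      if [measurable]: "g \<in> borel_measurable borel" for g :: "real \<Rightarrow> real"
      unfolding set_integrable_def by (rule integrable_completion) simp
    have "f absolutely_integrable_on (\<lambda>s. 1 / s) ` {0<..} \<and> integral ((\<lambda>s. 1 / s) ` {0<..}) f = integral {0<..} f"
      unfolding image leb[OF that(2)] using f by simp
    then have "(\<lambda>s. \<bar>- (1 / s\<^sup>2)\<bar> * f (1 / s)) absolutely_integrable_on {0<..} \<and>
        integral {0<..} (\<lambda>s. \<bar>- (1 / s\<^sup>2)\<bar> * f (1 / s)) = integral {0<..} f"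
      by (subst has_absolute_integral_change_of_variables_1')
         (auto intro!: derivative_eq_intros simp: inj_on_def power2_eq_square)
    then have 1: "(\<lambda>s. 1 / s\<^sup>2 * f (1 / s)) absolutely_integrable_on {0<..}"
      and 2: "integral {0<..} (\<lambda>s. 1 / s\<^sup>2 * f (1 / s)) = integral {0<..} f"
      by simp_all
    have 3: "set_integrable lborel {0<..} (\<lambda>s. 1 / s\<^sup>2 * f (1 / s))"
      using 1 by (subst leb[symmetric]) auto
    show ?thesis
      using 2 set_borel_integral_eq_integral(2)[OF 3] set_borel_integral_eq_integral(2)[OF f] 3 by simp
  qed
  have complex_parts: "set_integrable lborel {0<..} g \<longleftrightarrow>
      set_integrable lborel {0<..} (\<lambda>s. Re (g s)) \<and> set_integrable lborel {0<..} (\<lambda>s. Im (g s))"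
    for g :: "real \<Rightarrow> complex"
  proof
    assume *: "set_integrable lborel {0<..} g"
    then show "set_integrable lborel {0<..} (\<lambda>s. Re (g s)) \<and> set_integrable lborel {0<..} (\<lambda>s. Im (g s))"
      unfolding set_integrable_def using integrable_Re integrable_Im by fastforce
  next
    assume "set_integrable lborel {0<..} (\<lambda>s. Re (g s)) \<and> set_integrable lborel {0<..} (\<lambda>s. Im (g s))"
    then have "integrable lborel (\<lambda>s. complex_of_real (indicator {0<..} s *\<^sub>R Re (g s)) + \<i> * of_real (indicator {0<..} s *\<^sub>R Im (g s)))"
      unfolding set_integrable_def
      by (intro Bochner_Integration.integrable_add integrable_mult_right integrable_of_real) auto
    moreover have "(\<lambda>s. complex_of_real (indicator {0<..} s *\<^sub>R Re (g s)) + \<i> * of_real (indicator {0<..} s *\<^sub>R Im (g s)))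
        = (\<lambda>s. indicator {0<..} s *\<^sub>R g s)"
      by (auto simp: complex_eq_iff)
    ultimately show "set_integrable lborel {0<..} g" by (simp add: set_integrable_def)
  qed
  have KR: "set_integrable lborel {0<..} (\<lambda>s. Re (K s))" and KI: "set_integrable lborel {0<..} (\<lambda>s. Im (K s))"
    using K unfolding complex_parts by auto
  have R: "set_integrable lborel {0<..} (\<lambda>s. 1 / s\<^sup>2 * Re (K (1 / s)))"
      "(LINT s:{0<..}|lborel. 1 / s\<^sup>2 * Re (K (1 / s))) = (LINT s:{0<..}|lborel. Re (K s))"
    using real[OF KR] by simp_all
  have I: "set_integrable lborel {0<..} (\<lambda>s. 1 / s\<^sup>2 * Im (K (1 / s)))"
      "(LINT s:{0<..}|lborel. 1 / s\<^sup>2 * Im (K (1 / s))) = (LINT s:{0<..}|lborel. Im (K s))"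
    using real[OF KI] by simp_all
  have S: "set_integrable lborel {0<..} (\<lambda>s. of_real (1 / s\<^sup>2) * K (1 / s))"
    unfolding complex_parts using R(1) I(1) by simp
  have parts: "Re (LINT s:{0<..}|lborel. g s) = (LINT s:{0<..}|lborel. Re (g s))"
    "Im (LINT s:{0<..}|lborel. g s) = (LINT s:{0<..}|lborel. Im (g s))"
    if "set_integrable lborel {0<..} g" for g :: "real \<Rightarrow> complex"
    using that unfolding set_lebesgue_integral_def set_integrable_def
    by (simp_all flip: integral_Re integral_Im)
  show ?thesis
    by (rule complex_eqI) (simp_all only: parts[OF S] parts[OF K] R(2)[symmetric] I(2)[symmetric], simp_all)
qed

text \<open>Parametrising the ray by \<open>s > 0\<close> and substituting \<open>1 / s\<close>, the integral depends on
  \<open>\<tau>\<close> and \<open>z\<close> through \<open>y = \<tau> / z\<close> only and becomes Binet's second integral. The condition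
  \<open>Re y > 0\<close> says on which side of the line through the contour \<open>z\<close> lies.\<close>

lemma ray_integral_eq_binet:
  fixes \<tau> z :: complex
  assumes pos: "Re (\<tau> / z) > 0"
  shows "- (z / (of_real pi * \<i>)) * ray_integral (- \<i> * \<tau>)
     (\<lambda>u. 1 / (u\<^sup>2 - z\<^sup>2) * Ln (1 - exp (2 * of_real pi * \<i> * \<tau> / u))) = binet (\<tau> / z)"
proof -
  have nz: "\<tau> \<noteq> 0" "z \<noteq> 0" using pos by auto
  define y where "y = \<tau> / z"
  have y: "Re y > 0" "\<tau> = y * z" using pos nz by (auto simp: y_def)
  define K where "K = (\<lambda>s. complex_of_real (ln (1 - exp (- 2 * pi * s))) * (y / (y\<^sup>2 + (of_real s)\<^sup>2)))"
  have [measurable]: "K \<in> borel_measurable borel" by (simp add: K_def)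
  have "ray_integral (- \<i> * \<tau>) (\<lambda>u. 1 / (u\<^sup>2 - z\<^sup>2) * Ln (1 - exp (2 * of_real pi * \<i> * \<tau> / u)))
     = (LINT s:{0<..}|lborel. \<i> / z * (of_real (1 / s\<^sup>2) * K (1 / s)))"
    unfolding ray_integral_def
  proof (rule set_lebesgue_integral_cong)
    show "\<forall>s. s \<in> {0<..} \<longrightarrow> 1 / ((of_real s * (- \<i> * \<tau>))\<^sup>2 - z\<^sup>2) *
        Ln (1 - exp (2 * of_real pi * \<i> * \<tau> / (of_real s * (- \<i> * \<tau>)))) * (- \<i> * \<tau>)
        = \<i> / z * (of_real (1 / s\<^sup>2) * K (1 / s))"
    proof (intro allI impI)
      fix s :: real assume "s \<in> {0<..}"
      then have s: "s > 0" by simp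
      have "2 * of_real pi * \<i> * \<tau> / (of_real s * (- \<i> * \<tau>)) = - 2 * of_real pi / of_real s"
        using nz s by (simp add: divide_simps)
      then have "exp (2 * of_real pi * \<i> * \<tau> / (of_real s * (- \<i> * \<tau>))) = of_real (exp (- 2 * pi * (1 / s)))"
        by (simp add: exp_of_real[symmetric])
      then have L: "Ln (1 - exp (2 * of_real pi * \<i> * \<tau> / (of_real s * (- \<i> * \<tau>))))
          = of_real (ln (1 - exp (- 2 * pi * (1 / s))))"
        using s by (simp add: Ln_of_real[symmetric])
      have den: "(of_real s * (- \<i> * \<tau>))\<^sup>2 - z\<^sup>2 = - z\<^sup>2 * (y\<^sup>2 * of_real s ^ 2 + 1)"
        unfolding y by (simp add: power_mult_distrib algebra_simps)
      have frac: "- \<i> * \<tau> / (- z\<^sup>2 * (y\<^sup>2 * of_real s ^ 2 + 1)) = \<i> / z * (of_real (1 / s\<^sup>2) * (y / (y\<^sup>2 + (of_real (1 / s))\<^sup>2)))"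
      proof -
        have "y\<^sup>2 + (of_real (1 / s))\<^sup>2 = (y\<^sup>2 * of_real s ^ 2 + 1) / of_real s ^ 2"
          using s by (simp add: field_simps)
        then show ?thesis using nz s unfolding y(2) by (simp add: power2_eq_square)
      qed
      show "1 / ((of_real s * (- \<i> * \<tau>))\<^sup>2 - z\<^sup>2) *
        Ln (1 - exp (2 * of_real pi * \<i> * \<tau> / (of_real s * (- \<i> * \<tau>)))) * (- \<i> * \<tau>)
        = \<i> / z * (of_real (1 / s\<^sup>2) * K (1 / s))"
      proof -
        have "1 / D * l * m = l * (m / D)" for D l m :: complex by simp
        then have "1 / ((of_real s * (- \<i> * \<tau>))\<^sup>2 - z\<^sup>2) *
            Ln (1 - exp (2 * of_real pi * \<i> * \<tau> / (of_real s * (- \<i> * \<tau>)))) * (- \<i> * \<tau>)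
          = of_real (ln (1 - exp (- 2 * pi * (1 / s)))) * (- \<i> * \<tau> / (- z\<^sup>2 * (y\<^sup>2 * of_real s ^ 2 + 1)))"
          unfolding L den by blast
        also have "\<dots> = \<i> / z * (of_real (1 / s\<^sup>2) * K (1 / s))"
          unfolding frac K_def by (simp only: mult_ac)
        finally show ?thesis .
      qed
    qed
  qed simp
  also have "\<dots> = \<i> / z * (LINT s:{0<..}|lborel. K s)"
    unfolding set_integral_mult_right
    by (subst set_integral_inverse_substitution) (use binet_second_integral(1)[OF y(1)] in \<open>auto simp: K_def\<close>)
  finally show ?thesis
    unfolding y_def[symmetric] binet_second_integral(2)[OF y(1)] K_def[symmetric] using nz by (simp add: K_def)
qed

section \<open>Continuation to a half-plane\<close>

text \<open>The continuation of \<open>I_int t n\<close> along the half-plane centred at \<open>v\<close>: the side of the wall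
  is decided once and for all at \<open>v\<close> and then kept, even where \<open>z\<close> is on the other side.\<close>

definition continued_I :: "complex \<Rightarrow> complex \<Rightarrow> int \<Rightarrow> complex \<Rightarrow> complex" where
  "continued_I t v n z =
     (if Re ((t + of_int n) * cnj v) > 0 then binet ((t + of_int n) / z) else - binet (- ((t + of_int n) / z)))"

definition continued_pair :: "complex \<Rightarrow> complex \<Rightarrow> nat \<Rightarrow> complex \<Rightarrow> complex" where
  "continued_pair t v k z = continued_I t v (int (Suc k)) z + continued_I t v (- int (Suc k)) z"

definition continued_log :: "complex \<Rightarrow> complex \<Rightarrow> complex \<Rightarrow> complex" where
  "continued_log t v z = continued_I t v 0 z + (\<Sum>k. continued_pair t v k z)"

text \<open>A direction \<open>v\<close> off all lines spanned by the BPS rays: \<open>Re (\<tau> * cnj v) = 0\<close> describes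
  the line through \<open>\<i> \<tau>\<close>, and \<open>\<tau> = 1\<close> gives the accumulation line.\<close>

definition generic_direction :: "complex \<Rightarrow> complex \<Rightarrow> bool" where
  "generic_direction t v \<longleftrightarrow> Re v \<noteq> 0 \<and> (\<forall>n. Re ((t + of_int n) * cnj v) \<noteq> 0)"

lemma generic_direction_nonzero:
  "generic_direction t v \<Longrightarrow> Re ((t + of_int n) * cnj v) \<noteq> 0"
  unfolding generic_direction_def by blast

text \<open>On the side \<open>Re ((t + n) / z) < 0\<close> the integral is computed from the other side, since
  \<open>I_int\<close> is odd in \<open>z\<close>.\<close>

lemma I_int_eq_continued_I:
  assumes "Re ((t + of_int n) * cnj z) \<noteq> 0"
  shows "I_int t n z = continued_I t z n z"
proof (cases "Re ((t + of_int n) * cnj z) > 0")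
  case True
  then have "Re ((t + of_int n) / z) > 0" by (simp add: Re_complex_div_gt_0)
  from ray_integral_eq_binet[OF this] True show ?thesis
    unfolding I_int_def continued_I_def by (simp only: if_True)
next
  case False
  with assms have "Re ((t + of_int n) * cnj (- z)) > 0" by simp
  then have "Re ((t + of_int n) / (- z)) > 0" unfolding Re_complex_div_gt_0 .
  from ray_integral_eq_binet[OF this] False show ?thesis
    unfolding I_int_def continued_I_def by simp
qed

text \<open>If \<open>\<tau> = r z\<close> with \<open>r \<le> 0\<close>, then \<open>\<tau>\<close> and \<open>z\<close> cannot both have positive inner
  product with \<open>v\<close>. Consequently a branch of \<open>binet\<close> chosen at \<open>v\<close> extends to the
  whole half-plane centred at \<open>v\<close> without meeting the slit.\<close>

lemma quotient_not_nonpos: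
  assumes "z \<bullet> v > 0" "Re (\<tau> * cnj v) > 0"
  shows "\<tau> / z \<notin> \<real>\<^sub>\<le>\<^sub>0"
proof
  assume "\<tau> / z \<in> \<real>\<^sub>\<le>\<^sub>0"
  then obtain r where r: "\<tau> / z = of_real r" "r \<le> 0" by (auto elim!: nonpos_Reals_cases)
  have "z \<noteq> 0" using assms by auto
  then have "\<tau> = of_real r * z" using r(1) by (simp add: field_simps)
  then have "Re (\<tau> * cnj v) = r * (z \<bullet> v)" by (simp add: inner_complex_def algebra_simps)
  then show False using assms mult_nonpos_nonneg[OF r(2), of "z \<bullet> v"] by simp
qed

lemma continued_I_holomorphic:
  assumes "Re ((t + of_int n) * cnj v) \<noteq> 0"
  shows "continued_I t v n holomorphic_on {z. z \<bullet> v > 0}"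
proof (cases "Re ((t + of_int n) * cnj v) > 0")
  case True
  have "(binet \<circ> (\<lambda>z. (t + of_int n) / z)) holomorphic_on {z. z \<bullet> v > 0}"
    by (intro holomorphic_on_compose_gen[OF _ binet_holomorphic] holomorphic_intros)
       (use quotient_not_nonpos[OF _ True] in auto)
  then show ?thesis using True by (simp add: continued_I_def[abs_def] o_def)
next
  case False
  with assms have pos: "Re (- (t + of_int n) * cnj v) > 0"
    unfolding mult_minus_left uminus_complex.sel by linarith
  have "(binet \<circ> (\<lambda>z. - (t + of_int n) / z)) holomorphic_on {z. z \<bullet> v > 0}"
    by (intro holomorphic_on_compose_gen[OF _ binet_holomorphic] holomorphic_intros)
       (use quotient_not_nonpos[OF _ pos] in auto)
  then have "(\<lambda>z. - binet (- (t + of_int n) / z)) holomorphic_on {z. z \<bullet> v > 0}"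
    by (simp add: o_def holomorphic_on_minus)
  then show ?thesis using False by (simp only: continued_I_def[abs_def] minus_divide_left if_False)
qed

text \<open>The series of the \<open>I_int\<close> converges only after pairing \<open>n\<close> with \<open>- n\<close>, because \<open>binet y\<close>
  is of order \<open>1 / y\<close>. Differences gain one order, which is quantified here with a
  lower bound on \<open>x + y\<close> that grows with the index \<open>k\<close>.\<close>

lemma norm_binet_diff_le:
  assumes ck: "c > 0" "k > 0"
    and y: "\<And>x. x \<ge> 0 \<Longrightarrow> c * (x + k) \<le> norm (of_real x + y)"
    and y': "\<And>x. x \<ge> 0 \<Longrightarrow> c * (x + k) \<le> norm (of_real x + y')"
  shows "norm (binet y - binet y') \<le> weight_bound * norm (y - y') / c ^ 3 / k\<^sup>2"
proof -
  have slit: "u \<notin> \<real>\<^sub>\<le>\<^sub>0" if "\<And>x. x \<ge> 0 \<Longrightarrow> c * (x + k) \<le> norm (of_real x + u)" for u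
  proof
    assume "u \<in> \<real>\<^sub>\<le>\<^sub>0"
    then obtain r where r: "u = of_real r" "r \<le> 0" by (auto elim!: nonpos_Reals_cases)
    have "0 < c * (- r + k)" using ck r by (intro mult_pos_pos) auto
    with that[of "- r"] r show False by simp
  qed
  let ?W = "\<lambda>x. complex_of_real (weight x)"
  have i1: "set_integrable lborel {0..} (\<lambda>x. ?W x / (of_real x + y) ^ 2)"
    and i2: "set_integrable lborel {0..} (\<lambda>x. ?W x / (of_real x + y') ^ 2)"
    using set_integrable_weight[OF slit[OF y], of 0] set_integrable_weight[OF slit[OF y'], of 0] by simp_all
  define C where "C = weight_bound * norm (y - y') * (2 / c ^ 3)"
  have "binet y - binet y' = (LINT x:{0..}|lborel. ?W x / (of_real x + y) ^ 2 - ?W x / (of_real x + y') ^ 2)"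
    unfolding binet_def by (rule set_integral_diff(2)[OF i1 i2, symmetric])
  also have "norm \<dots> \<le> (LINT x:{0..}|lborel. C * (1 / (x + k) ^ (1 + 2)))"
  proof (rule norm_set_integral_le)
    show "set_integrable lborel {0..} (\<lambda>x. ?W x / (of_real x + y) ^ 2 - ?W x / (of_real x + y') ^ 2)"
      by (intro set_integral_diff(1) i1 i2)
    show "set_integrable lborel {0..} (\<lambda>x. C * (1 / (x + k) ^ (1 + 2)))"
      by (intro set_integrable_mult_right integral_inverse_power ck)
    fix x :: real assume "x \<in> {0..}"
    then have x: "x \<ge> 0" by simp
    define p q where "p = of_real x + y" "q = of_real x + y'"
    define e where "e = c * (x + k)"
    have pos: "0 < e" unfolding e_def using ck x by (intro mult_pos_pos) auto
    have p: "e \<le> norm p" and q: "e \<le> norm q"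
      using y[OF x] y'[OF x] by (simp_all add: p_q_def e_def)
    have nz: "p \<noteq> 0" "q \<noteq> 0" using p q pos by auto
    have pq: "q - p = y' - y" by (simp add: p_q_def)
    have "1 / p ^ 2 - 1 / q ^ 2 = (q - p) * (1 / (p * q ^ 2) + 1 / (p ^ 2 * q))"
      using nz by (simp add: divide_simps) algebra
    then have "norm (?W x / p ^ 2 - ?W x / q ^ 2) = norm (?W x) * (norm (y - y') * norm (1 / (p * q ^ 2) + 1 / (p ^ 2 * q)))"
      by (metis (no_types, lifting) pq divide_inverse right_diff_distrib' norm_mult norm_minus_commute mult_1)
    also have "\<dots> \<le> weight_bound * (norm (y - y') * (2 / (c * (x + k)) ^ 3))"
    proof (intro mult_mono norm_weight_le order_refl)
      have "norm (1 / (p * q ^ 2) + 1 / (p ^ 2 * q)) \<le> norm (1 / (p * q ^ 2)) + norm (1 / (p ^ 2 * q))"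
        by (rule norm_triangle_ineq)
      also have "\<dots> = 1 / (norm p * norm q ^ 2) + 1 / (norm p ^ 2 * norm q)"
        by (simp add: norm_divide norm_mult norm_power)
      also have "\<dots> \<le> 1 / (e * e ^ 2) + 1 / (e ^ 2 * e)"
        using p q pos less_imp_le[OF pos]
        by (intro add_mono divide_left_mono mult_mono power_mono mult_pos_pos) auto
      also have "\<dots> = 2 / e ^ 3"
        by (simp add: power2_eq_square power3_eq_cube)
      finally show "norm (1 / (p * q ^ 2) + 1 / (p ^ 2 * q)) \<le> 2 / (c * (x + k)) ^ 3"
        by (simp only: e_def)
    qed (use weight_bound_nonneg in auto)
    also have "\<dots> = C * (1 / (x + k) ^ (1 + 2))"
      by (simp add: C_def power_mult_distrib eval_nat_numeral mult_ac)
    finally show "norm (?W x / (of_real x + y) ^ 2 - ?W x / (of_real x + y') ^ 2) \<le> C * (1 / (x + k) ^ (1 + 2))"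
      by (simp add: p_q_def)
  qed
  also have "\<dots> = C * (1 / (2 * k\<^sup>2))"
    unfolding set_integral_mult_right integral_inverse_power(2)[OF ck(2)] by (simp add: power2_eq_square)
  also have "\<dots> = weight_bound * norm (y - y') / c ^ 3 / k\<^sup>2"
    using ck by (simp add: C_def power2_eq_square)
  finally show ?thesis .
qed

text \<open>For \<open>Re v > 0\<close> and large \<open>k\<close> the two signs are opposite, so the pair is a difference
  \<open>binet ((k + t) / z) - binet ((k - t) / z)\<close>, whose arguments are at distance \<open>\<bar>2 t / z\<bar>\<close>.
  Taking the inner product of \<open>x z + k \<plusminus> t\<close> with \<open>v\<close> gives the linear lower bound
  in \<open>x + k\<close>, locally uniformly in \<open>z\<close>.\<close>

lemma continued_pair_bound:
  assumes v: "Re v > 0" and z0: "z0 \<bullet> v > 0"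
  obtains d C where "d > 0" "cball z0 d \<subseteq> {z. z \<bullet> v > 0}"
    "\<forall>\<^sub>F k in sequentially. \<forall>z\<in>cball z0 d. norm (continued_pair t v k z) \<le> C / (real (Suc k))\<^sup>2"
proof -
  have nv: "norm v > 0" using v by auto
  \<comment> \<open>on the ball of radius \<open>d\<close> the inner product with \<open>v\<close> stays at least half of its value at \<open>z0\<close>\<close>
  define \<delta> where "\<delta> = (z0 \<bullet> v) / 2"
  define d where "d = \<delta> / norm v"
  have \<delta>: "\<delta> > 0" and d: "d > 0" using z0 nv by (auto simp: \<delta>_def d_def)
  define B where "B = norm z0 + d"
  have B: "B > 0" using d by (simp add: B_def add_nonneg_pos)
  have ball: "z \<bullet> v \<ge> \<delta> \<and> norm z \<le> B" if "z \<in> cball z0 d" for z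
  proof -
    have dz: "norm (z0 - z) \<le> d" using that by (simp add: dist_norm)
    have "(z0 - z) \<bullet> v \<le> norm (z0 - z) * norm v" by (rule norm_cauchy_schwarz)
    also have "\<dots> \<le> d * norm v" using dz nv by (intro mult_right_mono) auto
    also have "\<dots> = \<delta>" using nv by (simp add: d_def)
    finally have 1: "z \<bullet> v \<ge> \<delta>" by (simp add: inner_diff_left \<delta>_def)
    have "norm z \<le> norm z0 + norm (z0 - z)" by (metis norm_triangle_sub norm_minus_commute)
    with dz 1 show ?thesis by (simp add: B_def)
  qed
  define c where "c = min \<delta> (Re v / 2) / (norm v * B)"
  have c: "c > 0" using \<delta> v nv B by (simp add: c_def)
  define C where "C = weight_bound * (2 * norm t * norm v / \<delta>) / c ^ 3"
  show ?thesis
  proof (rule that[OF d])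
    show "cball z0 d \<subseteq> {z. z \<bullet> v > 0}" using ball \<delta> by fastforce
    \<comment> \<open>from \<open>K\<close> on, \<open>k * Re v\<close> dominates \<open>t \<bullet> v\<close>: the signs are settled and half of \<open>k * Re v\<close> remains\<close>
    obtain K :: nat where K: "real K > 2 * \<bar>t \<bullet> v\<bar> / Re v" using reals_Archimedean2 by blast
    show "\<forall>\<^sub>F k in sequentially. \<forall>z\<in>cball z0 d. norm (continued_pair t v k z) \<le> C / (real (Suc k))\<^sup>2"
      using eventually_ge_at_top[of K]
    proof eventually_elim
      case (elim k)
      define m where "m = real (Suc k)"
      have m: "m > 0" "m * Re v / 2 > \<bar>t \<bullet> v\<bar>"
      proof -
        show "m > 0" by (simp add: m_def)
        have "2 * \<bar>t \<bullet> v\<bar> / Re v < m" using K elim by (simp add: m_def)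
        then show "m * Re v / 2 > \<bar>t \<bullet> v\<bar>" using v by (simp add: field_simps)
      qed
      have s1: "Re ((t + of_int (int (Suc k))) * cnj v) = m * Re v + t \<bullet> v"
        and s2: "Re ((t + of_int (- int (Suc k))) * cnj v) = - (m * Re v) + t \<bullet> v"
        by (simp_all add: m_def inner_complex_def algebra_simps)
      have mv: "m * Re v > 0" using m v by simp
      have sgn: "Re ((t + of_int (int (Suc k))) * cnj v) > 0" "\<not> Re ((t + of_int (- int (Suc k))) * cnj v) > 0"
        unfolding s1 s2 using m(2) mv by linarith+
      have pair: "continued_pair t v k z = binet ((of_real m + t) / z) - binet ((of_real m - t) / z)" for z
        using sgn unfolding continued_pair_def continued_I_def
        by (simp add: m_def minus_divide_left add.commute)
      show ?case
      proof
        fix z assume "z \<in> cball z0 d"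
        then have z: "z \<bullet> v \<ge> \<delta>" "norm z \<le> B" using ball by auto
        then have z_nz: "z \<noteq> 0" using \<delta> by auto
        have lower: "c * (x + m) \<le> norm (of_real x + (of_real m + u) / z)"
          if u: "u \<bullet> v \<ge> - \<bar>t \<bullet> v\<bar>" and x: "x \<ge> 0" for u x
        proof -
          have "min \<delta> (Re v / 2) * (x + m) \<le> \<delta> * x + (Re v / 2) * m"
            unfolding distrib_left using x m by (intro add_mono mult_right_mono) auto
          also have "\<dots> \<le> x * (z \<bullet> v) + (m * Re v + u \<bullet> v)"
            using mult_left_mono[OF z(1) x] m(2) u by (simp add: algebra_simps)
          also have "\<dots> = (of_real x * z + (of_real m + u)) \<bullet> v"
            by (simp add: inner_complex_def algebra_simps)
          also have "\<dots> \<le> norm (of_real x * z + (of_real m + u)) * norm v" by (rule norm_cauchy_schwarz)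
          also have "of_real x * z + (of_real m + u) = z * (of_real x + (of_real m + u) / z)"
            using z_nz by (simp add: field_simps)
          also have "norm \<dots> * norm v \<le> B * norm (of_real x + (of_real m + u) / z) * norm v"
            unfolding norm_mult using z by (intro mult_right_mono) auto
          finally show ?thesis using nv B by (simp add: c_def field_simps)
        qed
        have "norm (continued_pair t v k z) \<le> weight_bound * norm ((of_real m + t) / z - (of_real m - t) / z) / c ^ 3 / m\<^sup>2"
          unfolding pair
        proof (rule norm_binet_diff_le[OF c m(1)])
          fix x :: real assume "x \<ge> 0"
          then show "c * (x + m) \<le> norm (of_real x + (of_real m + t) / z)"
            "c * (x + m) \<le> norm (of_real x + (of_real m - t) / z)"
            using lower[of t x] lower[of "- t" x] by auto
        qed
        also have "(of_real m + t) / z - (of_real m - t) / z = 2 * t / z"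
          by (simp add: diff_divide_distrib[symmetric])
        also have "norm (2 * t / z) \<le> 2 * norm t * norm v / \<delta>"
        proof -
          have "\<delta> \<le> norm z * norm v" using z norm_cauchy_schwarz[of z v] by linarith
          from mult_left_mono[OF this norm_ge_zero[of t]] show ?thesis using \<delta> nv z_nz
            by (simp add: norm_divide norm_mult field_simps)
        qed
        finally show "norm (continued_pair t v k z) \<le> C / (real (Suc k))\<^sup>2"
          using c weight_bound_nonneg by (simp add: C_def m_def divide_right_mono mult_left_mono)
      qed
    qed
  qed
qed

text \<open>This oddness carries the convergence from \<open>Re v > 0\<close> over to \<open>Re v < 0\<close>.\<close>

lemma continued_I_uminus:
  assumes "Re ((t + of_int n) * cnj v) \<noteq> 0"
  shows "continued_I t (- v) n (- z) = - continued_I t v n z"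
  using assms by (auto simp: continued_I_def)

lemma generic_direction_uminus: "generic_direction t (- v) \<longleftrightarrow> generic_direction t v"
  by (simp only: generic_direction_def complex_cnj_minus mult_minus_right uminus_complex.sel
      neg_equal_0_iff_equal)

lemma continued_pair_uminus:
  assumes "generic_direction t v"
  shows "continued_pair t (- v) k (- z) = - continued_pair t v k z"
proof -
  show ?thesis
    unfolding continued_pair_def continued_I_uminus[OF generic_direction_nonzero[OF assms]] by simp
qed

lemma continued_log_converges_right:
  assumes gen: "generic_direction t v" and v: "Re v > 0"
  shows "(\<lambda>z. \<Sum>k. continued_pair t v k z) holomorphic_on {z. z \<bullet> v > 0}"
    and "z \<bullet> v > 0 \<Longrightarrow> summable (\<lambda>k. continued_pair t v k z)"
proof -
  have op: "open {z. z \<bullet> v > 0}" using open_halfspace_gt[of 0 v] by (simp add: inner_commute)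
  have hol: "continued_pair t v k holomorphic_on {z. z \<bullet> v > 0}" for k
    unfolding continued_pair_def[abs_def]
    by (intro holomorphic_on_add continued_I_holomorphic generic_direction_nonzero[OF gen])
  show "(\<lambda>z. \<Sum>k. continued_pair t v k z) holomorphic_on {z. z \<bullet> v > 0}"
  proof (rule holomorphic_uniform_sequence[OF op])
    show "(\<lambda>z. \<Sum>k<n. continued_pair t v k z) holomorphic_on {z. z \<bullet> v > 0}" for n
      by (intro holomorphic_on_sum hol)
    fix z0 assume "z0 \<in> {z. z \<bullet> v > 0}"
    then obtain d C where "d > 0" "cball z0 d \<subseteq> {z. z \<bullet> v > 0}"
      "\<forall>\<^sub>F k in sequentially. \<forall>z\<in>cball z0 d. norm (continued_pair t v k z) \<le> C / (real (Suc k))\<^sup>2"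
      using continued_pair_bound[OF v] by blast
    then show "\<exists>d>0. cball z0 d \<subseteq> {z. z \<bullet> v > 0} \<and>
        uniform_limit (cball z0 d) (\<lambda>n z. \<Sum>k<n. continued_pair t v k z) (\<lambda>z. \<Sum>k. continued_pair t v k z) sequentially"
      by (intro exI[of _ d] conjI Weierstrass_m_test_ev[OF _ summable_over_squares])
  qed
  assume "z \<bullet> v > 0"
  then obtain d C where "d > 0" "cball z d \<subseteq> {z. z \<bullet> v > 0}"
      "\<forall>\<^sub>F k in sequentially. \<forall>z\<in>cball z d. norm (continued_pair t v k z) \<le> C / (real (Suc k))\<^sup>2"
    using continued_pair_bound[OF v] by blast
  then have "\<forall>\<^sub>F k in sequentially. norm (continued_pair t v k z) \<le> C / (real (Suc k))\<^sup>2"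
    by (auto elim!: eventually_mono)
  then show "summable (\<lambda>k. continued_pair t v k z)"
    by (rule summable_comparison_test_ev[OF _ summable_over_squares])
qed

lemma continued_log_converges:
  assumes gen: "generic_direction t v"
  shows continued_log_holomorphic: "continued_log t v holomorphic_on {z. z \<bullet> v > 0}"
    and summable_continued_pair: "z \<bullet> v > 0 \<Longrightarrow> summable (\<lambda>k. continued_pair t v k z)"
proof -
  have gen': "generic_direction t (- v)" using gen by (simp add: generic_direction_uminus)
  have minus: "continued_pair t v k z = - continued_pair t (- v) k (- z)" for k z
    using continued_pair_uminus[OF gen] by simp
  have *: "(\<lambda>z. \<Sum>k. continued_pair t v k z) holomorphic_on {z. z \<bullet> v > 0} \<and>
     (z \<bullet> v > 0 \<longrightarrow> summable (\<lambda>k. continued_pair t v k z))" for z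
  proof (cases "Re v > 0")
    case True
    then show ?thesis using continued_log_converges_right[OF gen True] by blast
  next
    case False
    then have v: "Re (- v) > 0" using gen by (simp add: generic_direction_def)
    note L = continued_log_converges_right[OF gen' v]
    have "((\<lambda>z. \<Sum>k. continued_pair t (- v) k z) \<circ> uminus) holomorphic_on {z. z \<bullet> v > 0}"
      by (rule holomorphic_on_compose_gen[OF _ L(1)]) (auto intro!: holomorphic_intros)
    then have "(\<lambda>z. - (\<Sum>k. continued_pair t (- v) k (- z))) holomorphic_on {z. z \<bullet> v > 0}"
      by (simp add: o_def holomorphic_on_minus)
    moreover have "- (\<Sum>k. continued_pair t (- v) k (- z)) = (\<Sum>k. continued_pair t v k z)" if "z \<bullet> v > 0" for z
      unfolding minus[of _ z] by (rule suminf_minus[symmetric], rule L(2)) (use that in auto)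
    ultimately have "(\<lambda>z. \<Sum>k. continued_pair t v k z) holomorphic_on {z. z \<bullet> v > 0}"
      by (subst holomorphic_cong[OF refl, of _ _ "\<lambda>z. - (\<Sum>k. continued_pair t (- v) k (- z))"]) auto
    moreover have "z \<bullet> v > 0 \<longrightarrow> summable (\<lambda>k. continued_pair t v k z)"
      unfolding minus[of _ z] summable_minus_iff using L(2)[of "- z"] by simp
    ultimately show ?thesis by blast
  qed
  show "continued_log t v holomorphic_on {z. z \<bullet> v > 0}"
    unfolding continued_log_def[abs_def]
    by (intro holomorphic_on_add continued_I_holomorphic generic_direction_nonzero[OF gen])
       (use * in blast)
  show "z \<bullet> v > 0 \<Longrightarrow> summable (\<lambda>k. continued_pair t v k z)" using * by blast
qed

section \<open>Rays and sectors\<close>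

lemma generator_in_ray: "v \<in> ray v"
  by (auto simp: ray_def intro!: exI[of _ 1])

lemma half_plane_ray: "half_plane (ray v) = {z. z \<bullet> v > 0}"
proof -
  have "z \<bullet> (of_real s * v) = s * (z \<bullet> v)" for s z
    by (simp add: scaleR_conv_of_real[symmetric])
  then have "\<forall>x\<in>ray v. z \<bullet> x > 0" if "z \<bullet> v > 0" for z
    using that by (auto simp: ray_def)
  then show ?thesis using generator_in_ray by (auto simp: half_plane_def)
qed

lemma opposite_ray: "opposite (ray v) = ray (- v)"
  by (force simp: ray_def image_iff)

lemma opposite_opposite: "opposite (opposite l) = l"
  by (simp add: image_image)

lemma sector_commute: "sector r r' = sector r' r"
  unfolding sector_def by (metis (no_types, opaque_lifting) add.commute)

lemma sector_opposite: "sector (opposite r) (opposite r') = opposite (sector r r')"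
proof (intro equalityI subsetI)
  fix x assume "x \<in> sector (opposite r) (opposite r')"
  then obtain a b where "a \<in> r" "b \<in> r'" "x = - (a + b)" by (auto simp: sector_def)
  then show "x \<in> opposite (sector r r')" unfolding sector_def by blast
next
  fix x assume "x \<in> opposite (sector r r')"
  then obtain a b where "a \<in> r" "b \<in> r'" "x = - a + - b" by (auto simp: sector_def)
  then show "x \<in> sector (opposite r) (opposite r')" unfolding sector_def by blast
qed

lemma lies_between_opposite: "lies_between (opposite l) (opposite r) (opposite r') \<longleftrightarrow> lies_between l r r'"
proof -
  have "is_ray (opposite l)" if "is_ray l" for l
    using that opposite_ray unfolding is_ray_def by (metis neg_equal_0_iff_equal)
  then have "is_ray (opposite l) \<longleftrightarrow> is_ray l" using opposite_opposite by metis
  moreover have "opposite l \<subseteq> opposite S \<longleftrightarrow> l \<subseteq> S" for S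
    by (metis image_mono opposite_opposite)
  ultimately show ?thesis by (simp only: lies_between_def sector_opposite)
qed

lemma sector_cone:
  assumes "x \<in> sector (ray p) (ray p')" "y \<in> sector (ray p) (ray p')" "\<alpha> \<ge> 0" "\<beta> \<ge> 0" "\<alpha> + \<beta> > 0"
  shows "of_real \<alpha> * x + of_real \<beta> * y \<in> sector (ray p) (ray p')"
proof -
  obtain a b c d where abcd: "a > 0" "b > 0" "c > 0" "d > 0"
    and x: "x = of_real a * p + of_real b * p'" and y: "y = of_real c * p + of_real d * p'"
    using assms(1,2) by (auto simp: sector_def ray_def)
  have pos: "\<alpha> * s + \<beta> * s' > 0" if "s > 0" "s' > 0" for s s'
  proof (cases "\<alpha> = 0")
    case True
    then show ?thesis using assms that by simp
  next
    case False
    then show ?thesis using assms that by (intro add_pos_nonneg) auto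
  qed
  have "of_real \<alpha> * x + of_real \<beta> * y
     = of_real (\<alpha> * a + \<beta> * c) * p + of_real (\<alpha> * b + \<beta> * d) * p'"
    by (simp add: x y algebra_simps)
  then show ?thesis using pos[of a c] pos[of b d] abcd unfolding sector_def ray_def by blast
qed

section \<open>Chambers\<close>

lemma bps_raysI:
  "bps_ray t n \<in> bps_rays t" "opposite (bps_ray t n) \<in> bps_rays t"
  "bps_ray_infinity \<in> bps_rays t" "opposite bps_ray_infinity \<in> bps_rays t"
  by (auto simp: bps_rays_def Let_def)

lemma bps_rays_E:
  assumes "q \<in> bps_rays t"
  obtains n where "q = ray (\<i> * (t + of_int n))" | n where "q = ray (- (\<i> * (t + of_int n)))"
    | "q = ray \<i>" | "q = ray (- \<i>)"
  using assms unfolding bps_rays_def Let_def bps_ray_def bps_ray_infinity_def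
  by (auto simp: opposite_ray)

text \<open>The zero line of \<open>Re (\<tau> * cnj x)\<close> is spanned by \<open>\<i> \<tau>\<close>; for \<open>\<tau> = t + n\<close> and
  \<open>\<tau> = 1\<close> it is the union of a BPS ray, its negative, and \<open>0\<close>.\<close>

lemma wall_functional_zero:
  assumes "Re (\<tau> * cnj x) = 0" "x \<noteq> 0" "\<tau> \<noteq> 0"
  shows "x \<in> ray (\<i> * \<tau>) \<or> x \<in> ray (- (\<i> * \<tau>))"
proof -
  define s where "s = - Im (\<tau> * cnj x) / (cmod \<tau>)\<^sup>2"
  have "\<tau> * cnj x = \<i> * Im (\<tau> * cnj x)" using assms(1) by (simp add: complex_eq_iff)
  then have "cnj \<tau> * x = - \<i> * Im (\<tau> * cnj x)"
    by (metis complex_cnj_cnj complex_cnj_complex_of_real complex_cnj_i complex_cnj_mult mult_minus_left)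
  then have "\<tau> * cnj \<tau> * x = - \<i> * Im (\<tau> * cnj x) * \<tau>" by (simp add: mult.assoc) 
  then have "of_real ((cmod \<tau>)\<^sup>2) * x = - \<i> * Im (\<tau> * cnj x) * \<tau>"
    by (simp only: complex_norm_square)
  then have x: "x = of_real s * (\<i> * \<tau>)" using assms(3) by (simp add: s_def field_simps)
  then have "s \<noteq> 0" using assms(2) by auto
  then consider "s > 0" | "- s > 0" by linarith
  then show ?thesis
  proof cases
    case 1 then show ?thesis using x unfolding ray_def by blast
  next
    case 2
    moreover have "x = of_real (- s) * (- (\<i> * \<tau>))" using x by simp
    ultimately show ?thesis unfolding ray_def by blast
  qed
qed

text \<open>In a sector that no BPS ray meets, the functionals defining the walls have no zero; as the
  sector is convex, they keep their sign. So the branches chosen at one point of the sector are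
  correct on the whole sector.\<close>

lemma bps_free_sector_signs:
  assumes t: "Im t > 0" and r: "r \<in> bps_rays t" "r' \<in> bps_rays t"
    and free: "\<forall>q\<in>bps_rays t. q \<inter> sector r r' = {}"
    and x: "x \<in> sector r r'" and v: "v \<in> sector r r'"
    and \<tau>: "\<tau> = 1 \<or> \<tau> = t + of_int n"
  shows "Re (\<tau> * cnj x) \<noteq> 0" "Re (\<tau> * cnj x) > 0 \<longleftrightarrow> Re (\<tau> * cnj v) > 0"
proof -
  obtain p p' where p: "r = ray p" "r' = ray p'" using r by (metis bps_rays_E)
  have \<tau>0: "\<tau> \<noteq> 0" using \<tau> t by (auto simp: complex_eq_iff)
  have nz: "Re (\<tau> * cnj x) \<noteq> 0" if x: "x \<in> sector r r'" for x
  proof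
    assume zero: "Re (\<tau> * cnj x) = 0"
    show False
    proof (cases "x = 0")
      case True
      then obtain a b where ab: "a \<in> r" "b \<in> r'" "a + b = 0" using x by (auto simp: sector_def)
      \<comment> \<open>opposite bounding rays would make the sector the line through them, which contains \<open>r\<close>\<close>
      have "of_real 2 * a \<in> r"
      proof -
        obtain s where s: "s > 0" "a = of_real s * p" using ab(1) unfolding p ray_def by blast
        then have "of_real 2 * a = of_real (2 * s) * p" "2 * s > 0" by simp_all
        then show ?thesis unfolding p ray_def by blast
      qed
      moreover have "a = of_real 2 * a + b" using ab(3) by (simp add: algebra_simps)
      ultimately have "a \<in> sector r r'" using ab(2) unfolding sector_def by blast
      then show False using free r(1) ab(1) by blast
    next
      case False
      have "ray (\<i> * \<tau>) \<in> bps_rays t" "ray (- (\<i> * \<tau>)) \<in> bps_rays t"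
        using \<tau> bps_raysI(1,2)[of t n] bps_raysI(3,4)[of t] unfolding bps_ray_def bps_ray_infinity_def
        by (auto simp: opposite_ray)
      then show False using wall_functional_zero[OF zero False \<tau>0] free x by blast
    qed
  qed
  show "Re (\<tau> * cnj x) \<noteq> 0" by (rule nz[OF x])
  show "Re (\<tau> * cnj x) > 0 \<longleftrightarrow> Re (\<tau> * cnj v) > 0"
  proof (rule ccontr)
    define f where "f = (\<lambda>x. Re (\<tau> * cnj x))"
    assume "\<not> (Re (\<tau> * cnj x) > 0 \<longleftrightarrow> Re (\<tau> * cnj v) > 0)"
    then have "\<not> (f x > 0 \<longleftrightarrow> f v > 0)" "f x \<noteq> 0" "f v \<noteq> 0"
      using nz[OF x] nz[OF v] unfolding f_def by blast+
    then have opp: "f x * \<bar>f v\<bar> + f v * \<bar>f x\<bar> = 0" "\<bar>f v\<bar> > 0" "\<bar>f x\<bar> > 0"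
      by (auto simp: abs_if mult.commute)
    \<comment> \<open>the point where the segment from \<open>x\<close> to \<open>v\<close> crosses the wall, up to scaling\<close>
    have "of_real \<bar>f v\<bar> * x + of_real \<bar>f x\<bar> * v \<in> sector r r'"
      using x v opp(2,3) unfolding p by (intro sector_cone) auto
    from nz[OF this] have "f (of_real \<bar>f v\<bar> * x + of_real \<bar>f x\<bar> * v) \<noteq> 0"
      unfolding f_def .
    moreover have "f (of_real \<alpha> * x + of_real \<beta> * v) = f x * \<alpha> + f v * \<beta>" for \<alpha> \<beta>
      by (simp add: f_def algebra_simps)
    ultimately show False using opp(1) by simp
  qed
qed

lemma X_beta_dual_eq_continued:
  assumes t: "Im t > 0" and z: "z \<in> adjacent_sector t (ray v)"
  shows "X_beta_dual w t z = exp (2 * of_real pi * \<i> * Z_beta_dual w t / z) * exp (continued_log t v z)"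
proof -
  obtain r r' where S: "r \<in> bps_rays t" "r' \<in> bps_rays t" "\<forall>q\<in>bps_rays t. q \<inter> sector r r' = {}"
    "ray v \<subseteq> sector r r'" "z \<in> sector r r'"
    using z unfolding adjacent_sector_def by blast
  then have v: "v \<in> sector r r'" using generator_in_ray by blast
  have "I_int t n z = continued_I t v n z" for n
    using bps_free_sector_signs[OF t S(1,2,3,5) v, of "t + of_int n" n]
    by (subst I_int_eq_continued_I) (simp_all only: continued_I_def simp_thms)
  then have "log_X_inst t z = continued_log t v z"
    by (simp add: log_X_inst_def continued_log_def continued_pair_def)
  then show ?thesis by (simp add: X_beta_dual_def)
qed

text \<open>The continued function satisfies the description that defines \<open>X_ray\<close>, and it is the only one:
  any other candidate agrees with it on the ray itself, which accumulates at \<open>v\<close> inside the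
  connected half-plane.\<close>

lemma X_ray_eq_continued:
  assumes t: "Im t > 0" and r: "r \<in> bps_rays t" "r' \<in> bps_rays t"
    and free: "\<forall>q\<in>bps_rays t. q \<inter> sector r r' = {}" and l: "ray v \<subseteq> sector r r'"
    and z: "z \<bullet> v > 0"
  shows "X_ray w t (ray v) z = exp (2 * of_real pi * \<i> * Z_beta_dual w t / z) * exp (continued_log t v z)"
proof -
  have v: "v \<in> sector r r'" using l generator_in_ray by blast
  note sgn = bps_free_sector_signs(1)[OF t r free v v]
  have gen: "generic_direction t v"
    unfolding generic_direction_def using sgn[of 1] sgn[of "t + of_int n" n for n] by auto
  have v0: "v \<noteq> 0" using gen by (auto simp: generic_direction_def)
  define H where "H = half_plane (ray v)"
  have H: "H = {z. z \<bullet> v > 0}" by (simp add: H_def half_plane_ray)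
  have op: "open H" unfolding H using open_halfspace_gt[of 0 v] by (simp add: inner_commute)
  have conn: "connected H" unfolding H
    using convex_connected[OF convex_halfspace_gt[of 0 v]] by (simp add: inner_commute)
  define F where "F = (\<lambda>z. exp (2 * of_real pi * \<i> * Z_beta_dual w t / z) * exp (continued_log t v z))"
  have F_hol: "F holomorphic_on H"
    unfolding F_def H
    by (intro holomorphic_intros continued_log_holomorphic[OF gen]) auto
  have ray_sub: "ray v \<subseteq> H \<inter> adjacent_sector t (ray v)"
  proof
    fix x assume x: "x \<in> ray v"
    then obtain s where "s > 0" "x = of_real s * v" by (auto simp: ray_def)
    then have "x \<bullet> v > 0" using v0 by (simp add: scaleR_conv_of_real[symmetric])
    moreover have "x \<in> adjacent_sector t (ray v)"
      unfolding adjacent_sector_def using x l r free by blast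
    ultimately show "x \<in> H \<inter> adjacent_sector t (ray v)" by (simp add: H)
  qed
  have lim: "v islimpt ray v"
    unfolding islimpt_approachable
  proof (intro allI impI)
    fix e :: real assume e: "e > 0"
    define s where "s = 1 + e / (2 * norm v)"
    have s: "s > 0" "s \<noteq> 1" using e v0 by (auto simp: s_def add_pos_pos)
    have "of_real s * v - v = of_real (e / (2 * norm v)) * v" by (simp add: s_def algebra_simps)
    then have "dist (of_real s * v) v = e / 2"
      using e v0 by (simp add: dist_norm norm_mult norm_divide)
    then show "\<exists>x\<in>ray v. x \<noteq> v \<and> dist x v < e"
      using s e v0 by (intro bexI[of _ "of_real s * v"]) (auto simp: ray_def)
  qed
  have "X_ray w t (ray v) = restrict F H"
    unfolding X_ray_def H_def[symmetric]
  proof (rule the_equality)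
    show "restrict F H \<in> H \<rightarrow>\<^sub>E - {0} \<and> restrict F H holomorphic_on H \<and>
      (\<forall>z\<in>H \<inter> adjacent_sector t (ray v). restrict F H z = X_beta_dual w t z)"
    proof (intro conjI ballI)
      show "restrict F H \<in> H \<rightarrow>\<^sub>E - {0}" by (auto simp: F_def)
      show "restrict F H holomorphic_on H"
        by (subst holomorphic_cong[OF refl, of _ _ F]) (auto intro: F_hol)
      fix z assume "z \<in> H \<inter> adjacent_sector t (ray v)"
      then show "restrict F H z = X_beta_dual w t z"
        using X_beta_dual_eq_continued[OF t, of z v w] by (simp add: F_def)
    qed
  next
    fix g assume g: "g \<in> H \<rightarrow>\<^sub>E - {0} \<and> g holomorphic_on H \<and>
      (\<forall>z\<in>H \<inter> adjacent_sector t (ray v). g z = X_beta_dual w t z)"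
    have "g x = F x" if "x \<in> H" for x
    proof -
      have "g x - F x = 0"
      proof (rule analytic_continuation[of "\<lambda>x. g x - F x" H "ray v" v])
        show "(\<lambda>x. g x - F x) holomorphic_on H" using g F_hol by (intro holomorphic_intros) auto
        show "g x - F x = 0" if "x \<in> ray v" for x
        proof -
          have x: "x \<in> H" "x \<in> adjacent_sector t (ray v)" using that ray_sub by auto
          then have "g x = X_beta_dual w t x" using g by blast
          then show ?thesis using X_beta_dual_eq_continued[OF t x(2), of w] by (simp add: F_def)
        qed
        show "ray v \<subseteq> H" "v \<in> H" using ray_sub generator_in_ray by auto
      qed (use op conn lim that in auto)
      then show ?thesis by simp
    qed
    moreover have "g x = undefined" if "x \<notin> H" for x using g that by auto
    ultimately show "g = restrict F H" by (auto simp: restrict_def)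
  qed
  then show ?thesis using z by (simp add: H F_def)
qed

text \<open>Between \<open>l\<^sub>n\<close> and \<open>l\<^sub>n\<^sub>-\<^sub>1\<close> the wall functional with index \<open>m\<close> equals
  \<open>Im t * (a * (n - m) + b * (n - 1 - m))\<close>, so its sign is read off from the integers.\<close>

lemma chamber_signs:
  assumes t: "Im t > 0" and p: "p \<in> sector (bps_ray t n) (bps_ray t (n - 1))"
  obtains a b where "a > 0" "b > 0" "p = \<i> * (of_real a * (t + of_int n) + of_real b * (t + of_int n - 1))"
    "Re p < 0" "\<And>m. m < n \<Longrightarrow> Re ((t + of_int m) * cnj p) > 0" "\<And>m. m \<ge> n \<Longrightarrow> Re ((t + of_int m) * cnj p) < 0"
proof -
  obtain a b where ab: "a > 0" "b > 0" and p: "p = of_real a * (\<i> * (t + of_int n)) + of_real b * (\<i> * (t + of_int (n - 1)))"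
    using p unfolding sector_def bps_ray_def ray_def by blast
  have f: "Re ((t + of_int m) * cnj p) = Im t * (a * (n - m) + b * (n - 1 - m))" for m
    by (simp add: p algebra_simps)
  show ?thesis
  proof (rule that[OF ab])
    show "p = \<i> * (of_real a * (t + of_int n) + of_real b * (t + of_int n - 1))"
      by (simp add: p algebra_simps)
    have "Re p = - ((a + b) * Im t)" by (simp add: p algebra_simps)
    then show "Re p < 0" using ab t by simp
    show "Re ((t + of_int m) * cnj p) > 0" if "m < n" for m
      unfolding f using that ab t by (intro mult_pos_pos add_pos_nonneg) auto
    show "Re ((t + of_int m) * cnj p) < 0" if "m \<ge> n" for m
      unfolding f using that ab t
      by (intro mult_pos_neg add_nonpos_neg mult_nonneg_nonpos) (auto intro: mult_pos_neg)
  qed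
qed

lemma chamber_bps_free:
  assumes t: "Im t > 0"
  shows "\<forall>q\<in>bps_rays t. q \<inter> sector (bps_ray t n) (bps_ray t (n - 1)) = {}"
proof (intro ballI equals0I)
  fix q x assume q: "q \<in> bps_rays t" and x: "x \<in> q \<inter> sector (bps_ray t n) (bps_ray t (n - 1))"
  obtain a b where "Re x < 0" "\<And>m. m < n \<Longrightarrow> Re ((t + of_int m) * cnj x) > 0"
      "\<And>m. m \<ge> n \<Longrightarrow> Re ((t + of_int m) * cnj x) < 0"
    using chamber_signs[OF t, of x n] x by blast
  then have sgn: "Re x \<noteq> 0" "Re ((t + of_int m) * cnj x) \<noteq> 0" for m
    by (force, metis less_irrefl not_le)
  from q show False
  proof (cases rule: bps_rays_E)
    case (1 m)
    then obtain s where xs: "x = of_real s * (\<i> * (t + of_int m))" using x unfolding ray_def by blast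
    have "Re ((t + of_int m) * cnj x) = 0" unfolding xs by (simp add: algebra_simps)
    then show False using sgn by blast
  next
    case (2 m)
    then obtain s where xs: "x = of_real s * (- (\<i> * (t + of_int m)))" using x unfolding ray_def by blast
    have "Re ((t + of_int m) * cnj x) = 0" unfolding xs by (simp add: algebra_simps)
    then show False using sgn by blast
  qed (use x sgn in \<open>auto simp: ray_def\<close>)
qed

lemma opposite_bps_rays: "opposite q \<in> bps_rays t \<longleftrightarrow> q \<in> bps_rays t"
proof -
  have "opposite q \<in> bps_rays t" if "q \<in> bps_rays t" for q
    using that unfolding bps_rays_def Let_def by (auto simp: image_image)
  then show ?thesis using opposite_opposite by metis
qed

text \<open>Rays enter the computations only through a generator.\<close>

lemma lies_between_generator:
  assumes "lies_between l r r'"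
  obtains v where "l = ray v" "v \<in> sector r r'"
  using assms generator_in_ray unfolding lies_between_def is_ray_def by blast

lemma chamber_generator:
  assumes t: "Im t > 0" and v: "v \<in> sector (bps_ray t n) (bps_ray t (n - 1))"
  shows "generic_direction t v"
    and "Re ((t + of_int m) * cnj v) > 0 \<longleftrightarrow> m < n"
    and "Re ((t + of_int m) * cnj (- v)) > 0 \<longleftrightarrow> n \<le> m"
    and "z \<bullet> v > 0 \<Longrightarrow> X_ray w t (ray v) z =
      exp (2 * of_real pi * \<i> * Z_beta_dual w t / z) * exp (continued_log t v z)"
    and "z \<bullet> - v > 0 \<Longrightarrow> X_ray w t (ray (- v)) z =
      exp (2 * of_real pi * \<i> * Z_beta_dual w t / z) * exp (continued_log t (- v) z)"
proof -
  let ?r = "bps_ray t n" and ?r' = "bps_ray t (n - 1)"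
  have sub: "ray v \<subseteq> sector ?r ?r'"
  proof
    fix x assume "x \<in> ray v"
    then obtain s where "s > 0" "x = of_real s * v + of_real 0 * v" by (auto simp: ray_def)
    then show "x \<in> sector ?r ?r'"
      using sector_cone[of v "\<i> * (t + of_int n)" "\<i> * (t + of_int (n - 1))" v s 0] v
      unfolding bps_ray_def by simp
  qed
  have sub': "ray (- v) \<subseteq> sector (opposite ?r) (opposite ?r')"
    unfolding sector_opposite opposite_ray[symmetric] using sub by (rule image_mono)
  have free: "\<forall>q\<in>bps_rays t. q \<inter> sector ?r ?r' = {}" by (rule chamber_bps_free[OF t])
  have free': "\<forall>q\<in>bps_rays t. q \<inter> sector (opposite ?r) (opposite ?r') = {}"
  proof
    fix q assume "q \<in> bps_rays t"
    then have "opposite q \<inter> sector ?r ?r' = {}" using free opposite_bps_rays by blast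
    then show "q \<inter> sector (opposite ?r) (opposite ?r') = {}"
      unfolding sector_opposite by (auto simp: image_iff)
  qed
  have s: "Re v < 0" "\<And>m. m < n \<Longrightarrow> Re ((t + of_int m) * cnj v) > 0"
      "\<And>m. m \<ge> n \<Longrightarrow> Re ((t + of_int m) * cnj v) < 0"
    using chamber_signs[OF t v] by blast+
  have sgn: "Re ((t + of_int m) * cnj v) > 0 \<longleftrightarrow> m < n" "Re ((t + of_int m) * cnj v) < 0 \<longleftrightarrow> n \<le> m" for m
    using s(2,3)[of m] by linarith+
  show "Re ((t + of_int m) * cnj v) > 0 \<longleftrightarrow> m < n" by (rule sgn)
  show "Re ((t + of_int m) * cnj (- v)) > 0 \<longleftrightarrow> n \<le> m"
    unfolding complex_cnj_minus mult_minus_right uminus_complex.sel neg_0_less_iff_less by (rule sgn(2))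
  show "generic_direction t v"
    unfolding generic_direction_def using s(1) sgn by (metis less_irrefl not_le)
  show "X_ray w t (ray v) z = exp (2 * of_real pi * \<i> * Z_beta_dual w t / z) * exp (continued_log t v z)"
    if "z \<bullet> v > 0"
    by (rule X_ray_eq_continued[OF t _ _ free sub that]) (rule bps_raysI)+
  show "X_ray w t (ray (- v)) z = exp (2 * of_real pi * \<i> * Z_beta_dual w t / z) * exp (continued_log t (- v) z)"
    if "z \<bullet> - v > 0"
    by (rule X_ray_eq_continued[OF t _ _ free' sub' that]) (rule bps_raysI)+
qed

section \<open>Crossing walls\<close>

text \<open>Whether \<open>(t + m) / z\<close> lies in the upper or the lower half-plane is the same question as
  whether \<open>z\<close> lies in the half-plane centred at \<open>- l\<^sub>m\<close> or at \<open>l\<^sub>m\<close>.\<close>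

lemma Im_mult_cnj_eq_inner: "Im (\<tau> * cnj z) = - (z \<bullet> (\<i> * \<tau>))"
  by (simp add: inner_complex_def algebra_simps)

text \<open>In the half-plane centred at \<open>- l\<^sub>m\<close> the branches on the two sides of the wall differ by \<open>binet y + binet (- y)\<close>
  with \<open>Im y > 0\<close>.\<close>

lemma jump_across_negative_ray:
  assumes "Re ((t + of_int m) * cnj v) > 0" "\<not> Re ((t + of_int m) * cnj v') > 0"
    and z: "z \<bullet> (\<i> * (t + of_int m)) < 0"
  shows "exp (continued_I t v m z - continued_I t v' m z) = inverse (1 - exp (2 * of_real pi * \<i> * (t + of_int m) / z))"
proof -
  have "Im ((t + of_int m) / z) > 0"
    unfolding Im_complex_div_gt_0 Im_mult_cnj_eq_inner using z by simp
  from exp_binet_reflection[OF this] show ?thesis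
    using assms(1,2) unfolding continued_I_def by (simp add: mult.assoc)
qed

text \<open>In the half-plane centred at \<open>l\<^sub>m\<close> it is \<open>Im (- y) > 0\<close>, and the order of the two sides is reversed: hence the
  inverse factor, with the opposite exponent.\<close>

lemma jump_across_positive_ray:
  assumes "\<not> Re ((t + of_int m) * cnj v) > 0" "Re ((t + of_int m) * cnj v') > 0"
    and z: "z \<bullet> (\<i> * (t + of_int m)) > 0"
  shows "exp (continued_I t v m z - continued_I t v' m z) = 1 - exp (- 2 * of_real pi * \<i> * (t + of_int m) / z)"
proof -
  define y where "y = (t + of_int m) / z"
  have "Im y < 0"
    unfolding y_def Im_complex_div_lt_0 Im_mult_cnj_eq_inner using z by simp
  then have r: "exp (binet (- y) + binet y) = inverse (1 - exp (2 * pi * \<i> * (- y)))"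
    using exp_binet_reflection[of "- y"] by simp
  have "continued_I t v m z - continued_I t v' m z = - (binet (- y) + binet y)"
    using assms(1,2) unfolding continued_I_def y_def by simp
  then have "exp (continued_I t v m z - continued_I t v' m z) = inverse (exp (binet (- y) + binet y))"
    by (simp only: exp_minus)
  then show ?thesis unfolding r by (simp add: y_def mult.assoc)
qed

lemma continued_I_cong:
  assumes "Re ((t + of_int m) * cnj v) > 0 \<longleftrightarrow> Re ((t + of_int m) * cnj v') > 0"
  shows "continued_I t v m z = continued_I t v' m z"
  using assms unfolding continued_I_def by simp

lemma continued_log_diff_sums:
  assumes "generic_direction t v" "generic_direction t v'" "z \<bullet> v > 0" "z \<bullet> v' > 0"
  shows "(\<lambda>k. (continued_I t v (int (Suc k)) z - continued_I t v' (int (Suc k)) z)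
            + (continued_I t v (- int (Suc k)) z - continued_I t v' (- int (Suc k)) z)) sums
     (continued_log t v z - continued_log t v' z - (continued_I t v 0 z - continued_I t v' 0 z))"
proof -
  have "(\<lambda>k. continued_pair t v k z - continued_pair t v' k z) sums
      ((\<Sum>k. continued_pair t v k z) - (\<Sum>k. continued_pair t v' k z))"
    using assms by (intro sums_diff summable_sums summable_continued_pair)
  then show ?thesis by (simp add: continued_log_def continued_pair_def algebra_simps)
qed

lemma continued_log_diff_single:
  assumes gen: "generic_direction t v" "generic_direction t v'" "z \<bullet> v > 0" "z \<bullet> v' > 0"
    and same: "\<And>m. m \<noteq> n \<Longrightarrow> continued_I t v m z = continued_I t v' m z"
  shows "continued_log t v z - continued_log t v' z = continued_I t v n z - continued_I t v' n z"
proof -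
  define D where "D = (\<lambda>m. continued_I t v m z - continued_I t v' m z)"
  have D0: "D m = 0" if "m \<noteq> n" for m using same[OF that] by (simp add: D_def)
  have sums: "(\<lambda>k. D (int (Suc k)) + D (- int (Suc k))) sums (continued_log t v z - continued_log t v' z - D 0)"
    unfolding D_def by (rule continued_log_diff_sums[OF gen])
  show ?thesis
  proof (cases "n = 0")
    case True
    then have "(\<lambda>k. D (int (Suc k)) + D (- int (Suc k))) = (\<lambda>_. 0)" using D0 by auto
    with sums have "continued_log t v z - continued_log t v' z - D 0 = 0"
      using sums_unique2 sums_zero by metis
    then show ?thesis using True by (simp add: D_def)
  next
    case False
    \<comment> \<open>the series pairs the indices \<open>k + 1\<close> and \<open>- (k + 1)\<close>, so \<open>n\<close> sits in the pair number \<open>\<bar>n\<bar> - 1\<close>\<close>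
    define j where "j = nat \<bar>n\<bar> - 1"
    have j: "n = int (Suc j) \<or> n = - int (Suc j)" using False by (auto simp: j_def)
    have "D (int (Suc k)) + D (- int (Suc k)) = (if k = j then D n else 0)" for k
    proof (cases "k = j")
      case True
      have "D (int (Suc j)) + D (- int (Suc j)) = D n"
        using j
      proof
        assume n: "n = int (Suc j)"
        then have "- int (Suc j) \<noteq> n" by linarith
        from D0[OF this] show ?thesis by (simp only: n add_0_right)
      next
        assume n: "n = - int (Suc j)"
        then have "int (Suc j) \<noteq> n" by linarith
        from D0[OF this] show ?thesis by (simp only: n add_0_left)
      qed
      then show ?thesis using True by (simp only: refl if_True)
    next
      case False
      then have "int (Suc k) \<noteq> n" "- int (Suc k) \<noteq> n" using j by auto
      then show ?thesis using False D0 by simp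
    qed
    then have "(\<lambda>k. if k = j then D n else 0) sums (continued_log t v z - continued_log t v' z - D 0)"
      using sums by simp
    moreover have "(\<lambda>k. if k = j then D n else 0) sums D n"
      using sums_single[of j "\<lambda>_. D n"] by simp
    ultimately have "continued_log t v z - continued_log t v' z - D 0 = D n" by (rule sums_unique2)
    moreover have "D 0 = 0" using D0 False by simp
    ultimately show ?thesis by (simp add: D_def)
  qed
qed

lemma convergent_prod_one_minus_geometric:
  fixes c q :: complex
  assumes "norm q < 1"
  shows "convergent_prod (\<lambda>k. 1 - c * q ^ k)"
proof (rule abs_convergent_prod_imp_convergent_prod, rule summable_imp_abs_convergent_prod)
  have "summable (\<lambda>k. norm c * norm q ^ k)" using assms by (intro summable_mult summable_geometric) simp
  then show "summable (\<lambda>k. norm (1 - c * q ^ k - 1))" by (simp add: norm_mult norm_power)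
qed

text \<open>Both exponentials are geometric sequences in \<open>k\<close> with ratio \<open>exp (- 2 \<pi> \<i> / z)\<close>, which has
  norm less than \<open>1\<close> in the upper half-plane.\<close>

lemma convergent_prod_walls:
  assumes "Im z > 0"
  shows "convergent_prod (\<lambda>k. 1 - exp (- 2 * of_real pi * \<i> * (t + of_nat (Suc k)) / z))"
    and "convergent_prod (\<lambda>k. 1 - exp (2 * of_real pi * \<i> * (t - of_nat (Suc k)) / z))"
proof -
  define q where "q = exp (- 2 * of_real pi * \<i> / z)"
  have "Re (\<i> / z) = Im z / (cmod z)\<^sup>2" by (simp add: Re_divide cmod_power2)
  moreover have "- 2 * of_real pi * \<i> / z = of_real (- 2 * pi) * (\<i> / z)" by simp
  ultimately have "Re (- 2 * of_real pi * \<i> / z) = - 2 * pi * (Im z / (cmod z)\<^sup>2)"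
    by (simp only: Re_complex_of_real Im_complex_of_real times_complex.sel mult_zero_left diff_zero)
  moreover have "Im z / (cmod z)\<^sup>2 > 0" using assms by (intro divide_pos_pos) auto
  ultimately have q: "norm q < 1" unfolding q_def norm_exp_eq_Re
    by (simp only: exp_less_one_iff mult_less_0_iff) simp
  have qk: "exp (- 2 * of_real pi * \<i> * of_nat k / z) = q ^ k" for k
    unfolding q_def exp_of_nat_mult[symmetric] by (simp add: mult_ac)
  have "exp (- 2 * of_real pi * \<i> * (t + of_nat (Suc k)) / z)
      = exp (- 2 * of_real pi * \<i> * (t + 1) / z) * q ^ k" for k
    unfolding qk[symmetric] exp_add[symmetric] by (simp add: algebra_simps add_divide_distrib diff_divide_distrib)
  then show "convergent_prod (\<lambda>k. 1 - exp (- 2 * of_real pi * \<i> * (t + of_nat (Suc k)) / z))"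
    using convergent_prod_one_minus_geometric[OF q] by simp
  have "exp (2 * of_real pi * \<i> * (t - of_nat (Suc k)) / z)
      = exp (2 * of_real pi * \<i> * (t - 1) / z) * q ^ k" for k
    unfolding qk[symmetric] exp_add[symmetric] by (simp add: algebra_simps add_divide_distrib diff_divide_distrib)
  then show "convergent_prod (\<lambda>k. 1 - exp (2 * of_real pi * \<i> * (t - of_nat (Suc k)) / z))"
    using convergent_prod_one_minus_geometric[OF q] by simp
qed

text \<open>The exponential of the symmetrically summed series is a product of pairs of factors. Only because both
  products converge separately may the pairs be torn apart.\<close>

lemma exp_continued_log_diff_prod:
  assumes gen: "generic_direction t v" "generic_direction t v'" "z \<bullet> v > 0" "z \<bullet> v' > 0"
    and zero: "continued_I t v 0 z = continued_I t v' 0 z"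
    and f: "\<And>k. exp (continued_I t v (int (Suc k)) z - continued_I t v' (int (Suc k)) z) = f k"
    and g: "\<And>k. exp (continued_I t v (- int (Suc k)) z - continued_I t v' (- int (Suc k)) z) = g k"
    and conv: "convergent_prod f" "convergent_prod g"
  shows "exp (continued_log t v z - continued_log t v' z) = (\<Prod>k. f k) * (\<Prod>k. g k)"
proof -
  note S = continued_log_diff_sums[OF gen]
  have "exp (continued_log t v z - continued_log t v' z) = (\<Prod>k. f k * g k)"
    using prodinf_exp[OF sums_summable[OF S]] S unfolding exp_add f g
    by (simp add: sums_iff zero)
  also have "\<dots> = (\<Prod>k. f k) * (\<Prod>k. g k)" using conv by (rule prodinf_mult[symmetric])
  finally show ?thesis .
qed

lemma X_ray_ratio:
  fixes X X' E a b P :: complex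
  assumes "X = E * exp a" "X' = E * exp b" "exp (a - b) = P"
  shows "X = X' * P"
  using assms by (simp add: exp_diff field_simps)

text \<open>The wall between two neighbouring chambers is a positive combination of rays from both of
  them, so the intersection of the two half-planes lies in the half-plane centred at it.\<close>

lemma adjacent_chambers_wall:
  assumes v: "a > 0" "b > 0" "v = \<i> * (of_real a * \<tau> + of_real b * (\<tau> - 1))"
    and v': "a' > 0" "b' > 0" "v' = \<i> * (of_real a' * (\<tau> + 1) + of_real b' * \<tau>)"
  shows "z \<bullet> v > 0 \<Longrightarrow> z \<bullet> v' > 0 \<Longrightarrow> z \<bullet> (\<i> * \<tau>) > 0"
    and "z \<bullet> v < 0 \<Longrightarrow> z \<bullet> v' < 0 \<Longrightarrow> z \<bullet> (\<i> * \<tau>) < 0"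
proof -
  have wall: "a' * (z \<bullet> v) + b * (z \<bullet> v') = (a * a' + b * b' + 2 * a' * b) * (z \<bullet> (\<i> * \<tau>))"
    by (simp add: v(3) v'(3) inner_complex_def algebra_simps)
  have c: "a * a' + b * b' + 2 * a' * b > 0" using v(1,2) v'(1,2) by (intro add_pos_pos mult_pos_pos) auto
  show "z \<bullet> (\<i> * \<tau>) > 0" if "z \<bullet> v > 0" "z \<bullet> v' > 0"
  proof -
    have "a' * (z \<bullet> v) + b * (z \<bullet> v') > 0" using that v(2) v'(1) by (intro add_pos_pos mult_pos_pos) auto
    then show ?thesis unfolding wall using c by (simp add: zero_less_mult_iff)
  qed
  show "z \<bullet> (\<i> * \<tau>) < 0" if "z \<bullet> v < 0" "z \<bullet> v' < 0"
  proof -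
    have "a' * (z \<bullet> v) + b * (z \<bullet> v') < 0" using that v(2) v'(1) by (intro add_neg_neg mult_pos_neg) auto
    then show ?thesis unfolding wall using c by (simp add: mult_less_0_iff)
  qed
qed

lemma X_ray_cross_one_wall:
  assumes t: "Im t > 0"
    and l: "lies_between l (bps_ray t n) (bps_ray t (n - 1))"
    and l': "lies_between l' (bps_ray t (n + 1)) (bps_ray t n)"
  shows "z \<in> half_plane (opposite l) \<Longrightarrow> z \<in> half_plane (opposite l') \<Longrightarrow>
      X_ray w t (opposite l) z = X_ray w t (opposite l') z *
        inverse (1 - exp (2 * of_real pi * \<i> * (t + of_int n) / z))"
    and "z \<in> half_plane l \<Longrightarrow> z \<in> half_plane l' \<Longrightarrow>
      X_ray w t l z = X_ray w t l' z * (1 - exp (- 2 * of_real pi * \<i> * (t + of_int n) / z))"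
proof -
  from l obtain v where lv: "l = ray v" and v: "v \<in> sector (bps_ray t n) (bps_ray t (n - 1))"
    by (rule lies_between_generator)
  from l' obtain v' where lv': "l' = ray v'" and "v' \<in> sector (bps_ray t (n + 1)) (bps_ray t n)"
    by (rule lies_between_generator)
  then have v': "v' \<in> sector (bps_ray t (n + 1)) (bps_ray t (n + 1 - 1))" by simp
  note V = chamber_generator[OF t v] and V' = chamber_generator[OF t v']
  obtain a b where ab: "a > 0" "b > 0" "v = \<i> * (of_real a * (t + of_int n) + of_real b * (t + of_int n - 1))"
    using chamber_signs[OF t v] by metis
  obtain a' b' where ab': "a' > 0" "b' > 0"
    "v' = \<i> * (of_real a' * (t + of_int (n + 1)) + of_real b' * (t + of_int (n + 1) - 1))"
    using chamber_signs[OF t v'] by metis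
  have "v' = \<i> * (of_real a' * (t + of_int n + 1) + of_real b' * (t + of_int n))"
    by (simp add: ab'(3) algebra_simps)
  note wall = adjacent_chambers_wall[OF ab ab'(1,2) this, of z]
  have gen': "generic_direction t (- v)" "generic_direction t (- v')"
    using V(1) V'(1) by (simp_all only: generic_direction_uminus)
  show "X_ray w t (opposite l) z = X_ray w t (opposite l') z *
        inverse (1 - exp (2 * of_real pi * \<i> * (t + of_int n) / z))"
    if "z \<in> half_plane (opposite l)" "z \<in> half_plane (opposite l')"
  proof -
    have z: "z \<bullet> - v > 0" "z \<bullet> - v' > 0" using that unfolding lv lv' opposite_ray half_plane_ray by blast+
    then have "z \<bullet> (\<i> * (t + of_int n)) < 0" using wall(2) by simp
    then have jump: "exp (continued_I t (- v) n z - continued_I t (- v') n z)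
        = inverse (1 - exp (2 * of_real pi * \<i> * (t + of_int n) / z))"
      by (intro jump_across_negative_ray, unfold V(2,3) V'(2,3)) simp_all
    have "continued_log t (- v) z - continued_log t (- v') z = continued_I t (- v) n z - continued_I t (- v') n z"
      by (rule continued_log_diff_single[OF gen' z], rule continued_I_cong) (unfold V(2,3) V'(2,3), linarith)
    with jump show ?thesis
      unfolding lv lv' opposite_ray by (intro X_ray_ratio[OF V(5)[OF z(1)] V'(5)[OF z(2)]]) (simp only:)
  qed
  show "X_ray w t l z = X_ray w t l' z * (1 - exp (- 2 * of_real pi * \<i> * (t + of_int n) / z))"
    if "z \<in> half_plane l" "z \<in> half_plane l'"
  proof -
    have z: "z \<bullet> v > 0" "z \<bullet> v' > 0" using that unfolding lv lv' half_plane_ray by blast+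
    then have "z \<bullet> (\<i> * (t + of_int n)) > 0" using wall(1) by simp
    then have jump: "exp (continued_I t v n z - continued_I t v' n z)
        = 1 - exp (- 2 * of_real pi * \<i> * (t + of_int n) / z)"
      by (intro jump_across_positive_ray, unfold V(2,3) V'(2,3)) simp_all
    have "continued_log t v z - continued_log t v' z = continued_I t v n z - continued_I t v' n z"
      by (rule continued_log_diff_single[OF V(1) V'(1) z], rule continued_I_cong) (unfold V(2,3) V'(2,3), linarith)
    with jump show ?thesis
      unfolding lv lv' by (intro X_ray_ratio[OF V(4)[OF z(1)] V'(4)[OF z(2)]]) (simp only:)
  qed
qed

text \<open>With \<open>A\<close> and \<open>h\<close> the inner products of \<open>z\<close> with \<open>\<i> t\<close> and \<open>\<i>\<close>, the inner product with
  \<open>\<i> (t + m)\<close> is \<open>A + m h\<close>. The two half-plane conditions force \<open>h > \<bar>A\<bar>\<close>, which fixes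
  the signs for all \<open>m \<noteq> 0\<close> at once.\<close>

lemma opposite_chambers_inequalities:
  assumes ab: "a > 0" "b > 0" "a' > 0" "b' > 0"
    and z: "(a + b) * A + b * h > 0" "- (a' + b') * A + b' * h > 0"
    and m: "m \<ge> 1"
  shows "h > (0::real)" "A + m * h > 0" "A - m * h < 0"
proof -
  have 1: "b' * h > a' * A + b' * A" "b * h > - (a * A + b * A)" using z by (simp_all add: algebra_simps)
  show h: "h > 0"
  proof (cases "A \<ge> 0")
    case True
    then have "b' * h > 0" using 1(1) ab mult_nonneg_nonneg[of a' A] mult_nonneg_nonneg[of b' A] by linarith
    then show ?thesis using ab by (simp add: zero_less_mult_iff)
  next
    case False
    then have "a * A < 0" "b * A < 0" using ab by (auto intro: mult_pos_neg)
    then have "b * h > 0" using 1(2) by linarith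
    then show ?thesis using ab by (simp add: zero_less_mult_iff)
  qed
  then have mh: "m * h \<ge> h" using m by simp
  have "A + h > 0"
  proof (cases "A \<ge> 0")
    case True then show ?thesis using h by simp
  next
    case False
    then have "a * A < 0" using ab by (auto intro: mult_pos_neg)
    then have "b * (A + h) > 0" using 1(2) by (simp add: algebra_simps)
    then show ?thesis using ab by (simp add: zero_less_mult_iff)
  qed
  moreover have "h - A > 0"
  proof (cases "A \<le> 0")
    case True then show ?thesis using h by simp
  next
    case False
    then have "a' * A > 0" using ab by (auto intro: mult_pos_pos)
    then have "b' * (h - A) > 0" using 1(1) by (simp add: algebra_simps)
    then show ?thesis using ab by (simp add: zero_less_mult_iff)
  qed
  ultimately show "A + m * h > 0" "A - m * h < 0" using mh by linarith+
qed

text \<open>Turning counterclockwise from \<open>l'\<close> to \<open>l\<close> crosses \<open>- l\<^sub>n\<close> for all \<open>n < 0\<close>, then \<open>l\<^sub>n\<close> for all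
  \<open>n > 0\<close>, but neither \<open>l\<^sub>0\<close> nor \<open>- l\<^sub>0\<close>. Nothing is attached to the accumulation ray in
  between, because the two series are compared term by term.\<close>

lemma X_ray_cross_upper_walls:
  assumes t: "Im t > 0"
    and l: "lies_between l (bps_ray t 0) (bps_ray t 1)"
    and l': "lies_between l' (opposite (bps_ray t 0)) (opposite (bps_ray t (- 1)))"
    and z: "z \<in> half_plane l" "z \<in> half_plane l'"
  shows "X_ray w t l z = X_ray w t l' z *
      ((\<Prod>k. 1 - exp (- 2 * of_real pi * \<i> * (t + of_nat (Suc k)) / z)) *
       (\<Prod>k. inverse (1 - exp (2 * of_real pi * \<i> * (t - of_nat (Suc k)) / z))))"
proof -
  have "lies_between l (bps_ray t 1) (bps_ray t (1 - 1))"
    using l by (simp add: lies_between_def sector_commute)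
  then obtain v where lv: "l = ray v" and v: "v \<in> sector (bps_ray t 1) (bps_ray t (1 - 1))"
    by (rule lies_between_generator)
  have "lies_between (opposite (opposite l')) (opposite (bps_ray t 0)) (opposite (bps_ray t (0 - 1)))"
    using l' by (simp add: opposite_opposite)
  then have "lies_between (opposite l') (bps_ray t 0) (bps_ray t (0 - 1))"
    by (simp only: lies_between_opposite)
  then obtain v' where "opposite l' = ray v'" and v': "v' \<in> sector (bps_ray t 0) (bps_ray t (0 - 1))"
    by (rule lies_between_generator)
  then have lv': "l' = ray (- v')" by (metis opposite_opposite opposite_ray)
  note V = chamber_generator[OF t v] and V' = chamber_generator[OF t v']
  have gv': "generic_direction t (- v')" using V'(1) by (simp only: generic_direction_uminus)
  obtain a b where ab: "a > 0" "b > 0" "v = \<i> * (of_real a * (t + of_int 1) + of_real b * (t + of_int 1 - 1))"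
    using chamber_signs[OF t v] by metis
  obtain a' b' where ab': "a' > 0" "b' > 0" "v' = \<i> * (of_real a' * (t + of_int 0) + of_real b' * (t + of_int 0 - 1))"
    using chamber_signs[OF t v'] by metis
  have z: "z \<bullet> v > 0" "z \<bullet> - v' > 0" using z unfolding lv lv' half_plane_ray by blast+
  define A h where "A = z \<bullet> (\<i> * t)" "h = Im z"
  have zz: "(b + a) * A + a * h > 0" "- (a' + b') * A + b' * h > 0"
    using z by (simp_all add: ab(3) ab'(3) A_h_def inner_complex_def algebra_simps)
  note walls = opposite_chambers_inequalities[OF ab(2,1) ab'(1,2) zz]
  have h: "Im z > 0" using walls(1)[of 1] by (simp add: A_h_def)
  have left_index: "t + of_int (- int (Suc k)) = t - of_nat (Suc k)" for k by simp
  have w1: "z \<bullet> (\<i> * (t + of_int (int (Suc k)))) > 0" for k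
    using walls(2)[of "real (Suc k)"] by (simp add: A_h_def inner_complex_def algebra_simps)
  have w2: "z \<bullet> (\<i> * (t + of_int (- int (Suc k)))) < 0" for k
    using walls(3)[of "real (Suc k)"] by (simp add: A_h_def inner_complex_def algebra_simps)
  show ?thesis
  proof (rule X_ray_ratio[OF V(4)[OF z(1), folded lv] V'(5)[OF z(2), folded lv']], rule exp_continued_log_diff_prod[OF V(1) gv' z])
    show "continued_I t v 0 z = continued_I t (- v') 0 z"
      by (rule continued_I_cong) (unfold V(2,3) V'(2,3), simp)
    show "exp (continued_I t v (int (Suc k)) z - continued_I t (- v') (int (Suc k)) z) =
        1 - exp (- 2 * of_real pi * \<i> * (t + of_nat (Suc k)) / z)" for k
      by (subst jump_across_positive_ray[OF _ _ w1[of k]], unfold V(2,3) V'(2,3)) simp_all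
    show "exp (continued_I t v (- int (Suc k)) z - continued_I t (- v') (- int (Suc k)) z) =
        inverse (1 - exp (2 * of_real pi * \<i> * (t - of_nat (Suc k)) / z))" for k
      by (subst jump_across_negative_ray[OF _ _ w2[of k]], unfold V(2,3) V'(2,3), unfold left_index) simp_all
    show "convergent_prod (\<lambda>k. 1 - exp (- 2 * of_real pi * \<i> * (t + of_nat (Suc k)) / z))"
      "convergent_prod (\<lambda>k. inverse (1 - exp (2 * of_real pi * \<i> * (t - of_nat (Suc k)) / z)))"
      using convergent_prod_walls[OF h] by (simp_all only: convergent_prod_inverse_iff)
  qed
qed

text \<open>The mirror image of the previous crossing, in the lower half-plane; hence \<open>h\<close> is now
  \<open>- Im z\<close>.\<close>

lemma X_ray_cross_lower_walls:
  assumes t: "Im t > 0"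
    and l: "lies_between l (bps_ray t 0) (bps_ray t (- 1))"
    and l': "lies_between l' (opposite (bps_ray t 0)) (opposite (bps_ray t 1))"
    and z: "z \<in> half_plane l" "z \<in> half_plane l'"
  shows "X_ray w t l' z = X_ray w t l z *
      ((\<Prod>k. 1 - exp (- 2 * of_real pi * \<i> * (t - of_nat (Suc k)) / z)) *
       (\<Prod>k. inverse (1 - exp (2 * of_real pi * \<i> * (t + of_nat (Suc k)) / z))))"
proof -
  have "lies_between l (bps_ray t 0) (bps_ray t (0 - 1))" using l by simp
  then obtain v where lv: "l = ray v" and v: "v \<in> sector (bps_ray t 0) (bps_ray t (0 - 1))"
    by (rule lies_between_generator)
  have "lies_between (opposite (opposite l')) (opposite (bps_ray t 1)) (opposite (bps_ray t (1 - 1)))"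
    using l' by (simp add: opposite_opposite lies_between_def sector_commute)
  then have "lies_between (opposite l') (bps_ray t 1) (bps_ray t (1 - 1))"
    by (simp only: lies_between_opposite)
  then obtain v' where "opposite l' = ray v'" and v': "v' \<in> sector (bps_ray t 1) (bps_ray t (1 - 1))"
    by (rule lies_between_generator)
  then have lv': "l' = ray (- v')" by (metis opposite_opposite opposite_ray)
  note V = chamber_generator[OF t v] and V' = chamber_generator[OF t v']
  have gv': "generic_direction t (- v')" using V'(1) by (simp only: generic_direction_uminus)
  obtain a b where ab: "a > 0" "b > 0" "v = \<i> * (of_real a * (t + of_int 0) + of_real b * (t + of_int 0 - 1))"
    using chamber_signs[OF t v] by metis
  obtain a' b' where ab': "a' > 0" "b' > 0" "v' = \<i> * (of_real a' * (t + of_int 1) + of_real b' * (t + of_int 1 - 1))"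
    using chamber_signs[OF t v'] by metis
  have z: "z \<bullet> v > 0" "z \<bullet> - v' > 0" using z unfolding lv lv' half_plane_ray by blast+
  define A h where "A = z \<bullet> (\<i> * t)" "h = - Im z"
  have zz: "(a + b) * A + b * h > 0" "- (b' + a') * A + a' * h > 0"
    using z by (simp_all add: ab(3) ab'(3) A_h_def inner_complex_def algebra_simps)
  note walls = opposite_chambers_inequalities[OF ab(1,2) ab'(2,1) zz]
  have h: "Im (- z) > 0" using walls(1)[of 1] by (simp add: A_h_def)
  have left_index: "t + of_int (- int (Suc k)) = t - of_nat (Suc k)" for k by simp
  have w1: "z \<bullet> (\<i> * (t + of_int (int (Suc k)))) < 0" for k
    using walls(3)[of "real (Suc k)"] by (simp add: A_h_def inner_complex_def algebra_simps)
  have w2: "z \<bullet> (\<i> * (t + of_int (- int (Suc k)))) > 0" for k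
    using walls(2)[of "real (Suc k)"] by (simp add: A_h_def inner_complex_def algebra_simps)
  have "X_ray w t l' z = X_ray w t l z *
      ((\<Prod>k. inverse (1 - exp (2 * of_real pi * \<i> * (t + of_nat (Suc k)) / z))) *
       (\<Prod>k. 1 - exp (- 2 * of_real pi * \<i> * (t - of_nat (Suc k)) / z)))"
  proof (rule X_ray_ratio[OF V'(5)[OF z(2), folded lv'] V(4)[OF z(1), folded lv]], rule exp_continued_log_diff_prod[OF gv' V(1) z(2,1)])
    show "continued_I t (- v') 0 z = continued_I t v 0 z"
      by (rule continued_I_cong) (unfold V(2,3) V'(2,3), simp)
    show "exp (continued_I t (- v') (int (Suc k)) z - continued_I t v (int (Suc k)) z) =
        inverse (1 - exp (2 * of_real pi * \<i> * (t + of_nat (Suc k)) / z))" for k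
      by (subst jump_across_negative_ray[OF _ _ w1[of k]], unfold V(2,3) V'(2,3)) simp_all
    show "exp (continued_I t (- v') (- int (Suc k)) z - continued_I t v (- int (Suc k)) z) =
        1 - exp (- 2 * of_real pi * \<i> * (t - of_nat (Suc k)) / z)" for k
      by (subst jump_across_positive_ray[OF _ _ w2[of k]], unfold V(2,3) V'(2,3), unfold left_index) simp_all
    have neg: "- 2 * of_real pi * \<i> * u / (- z) = 2 * of_real pi * \<i> * u / z"
      "2 * of_real pi * \<i> * u / (- z) = - 2 * of_real pi * \<i> * u / z" for u
      by simp_all
    show "convergent_prod (\<lambda>k. inverse (1 - exp (2 * of_real pi * \<i> * (t + of_nat (Suc k)) / z)))"
      "convergent_prod (\<lambda>k. 1 - exp (- 2 * of_real pi * \<i> * (t - of_nat (Suc k)) / z))"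
      using convergent_prod_walls[OF h, of t] by (simp_all only: neg convergent_prod_inverse_iff)
  qed
  then show ?thesis by (simp only: mult_ac)
qed

theorem proposition39:
  fixes t w :: complex
  assumes "Im t > 0"
    and "exp w = exp (2 * of_real pi * \<i> * t)"
  shows "(\<forall>n l l'. lies_between l (bps_ray t n) (bps_ray t (n - 1)) \<and>
            lies_between l' (bps_ray t (n + 1)) (bps_ray t n) \<longrightarrow>
            (\<forall>z \<in> half_plane (opposite l) \<inter> half_plane (opposite l').
               X_ray w t (opposite l) z =
                 X_ray w t (opposite l') z *
                   inverse (1 - exp (2 * of_real pi * \<i> * (t + of_int n) / z))) \<and>
            (\<forall>z \<in> half_plane l \<inter> half_plane l'.
               X_ray w t l z =
                 X_ray w t l' z * (1 - exp (- 2 * of_real pi * \<i> * (t + of_int n) / z)))) \<and>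
         (\<forall>l l'. lies_between l (bps_ray t 0) (bps_ray t 1) \<and>
            lies_between l' (opposite (bps_ray t 0)) (opposite (bps_ray t (- 1))) \<longrightarrow>
            (\<forall>z \<in> half_plane l \<inter> half_plane l'.
               X_ray w t l z =
                 X_ray w t l' z *
                   (\<Prod>k. 1 - exp (- 2 * of_real pi * \<i> * (t + of_nat (Suc k)) / z)) *
                   (\<Prod>k. inverse (1 - exp (2 * of_real pi * \<i> * (t - of_nat (Suc k)) / z))))) \<and>
         (\<forall>l l'. lies_between l (bps_ray t 0) (bps_ray t (- 1)) \<and>
            lies_between l' (opposite (bps_ray t 0)) (opposite (bps_ray t 1)) \<longrightarrow>
            (\<forall>z \<in> half_plane l \<inter> half_plane l'.
               X_ray w t l' z =
                 X_ray w t l z *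
                   (\<Prod>k. 1 - exp (- 2 * of_real pi * \<i> * (t - of_nat (Suc k)) / z)) *
                   (\<Prod>k. inverse (1 - exp (2 * of_real pi * \<i> * (t + of_nat (Suc k)) / z)))))"
proof (intro conjI allI impI ballI; (elim conjE IntE)?)
  note t = assms(1)
  show "X_ray w t (opposite l) z = X_ray w t (opposite l') z *
      inverse (1 - exp (2 * of_real pi * \<i> * (t + of_int n) / z))"
    if "lies_between l (bps_ray t n) (bps_ray t (n - 1))" "lies_between l' (bps_ray t (n + 1)) (bps_ray t n)"
      "z \<in> half_plane (opposite l)" "z \<in> half_plane (opposite l')" for n l l' z
    using X_ray_cross_one_wall(1)[OF t that] .
  show "X_ray w t l z = X_ray w t l' z * (1 - exp (- 2 * of_real pi * \<i> * (t + of_int n) / z))"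
    if "lies_between l (bps_ray t n) (bps_ray t (n - 1))" "lies_between l' (bps_ray t (n + 1)) (bps_ray t n)"
      "z \<in> half_plane l" "z \<in> half_plane l'" for n l l' z
    using X_ray_cross_one_wall(2)[OF t that] .
  show "X_ray w t l z = X_ray w t l' z *
      (\<Prod>k. 1 - exp (- 2 * of_real pi * \<i> * (t + of_nat (Suc k)) / z)) *
      (\<Prod>k. inverse (1 - exp (2 * of_real pi * \<i> * (t - of_nat (Suc k)) / z)))"
    if "lies_between l (bps_ray t 0) (bps_ray t 1)"
      "lies_between l' (opposite (bps_ray t 0)) (opposite (bps_ray t (- 1)))"
      "z \<in> half_plane l" "z \<in> half_plane l'" for l l' z
    using X_ray_cross_upper_walls[OF t that] unfolding mult.assoc .
  show "X_ray w t l' z = X_ray w t l z *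
      (\<Prod>k. 1 - exp (- 2 * of_real pi * \<i> * (t - of_nat (Suc k)) / z)) *
      (\<Prod>k. inverse (1 - exp (2 * of_real pi * \<i> * (t + of_nat (Suc k)) / z)))"
    if "lies_between l (bps_ray t 0) (bps_ray t (- 1))"
      "lies_between l' (opposite (bps_ray t 0)) (opposite (bps_ray t 1))"
      "z \<in> half_plane l" "z \<in> half_plane l'" for l l' z
    using X_ray_cross_lower_walls[OF t that] unfolding mult.assoc .
qed

end
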